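(* Let $\nu>0$, $T>0$ and let $\Omega\subset\mathbb{R}^d$, $d\ge2$, be a domain, possibly with boundary. Let $u^\nu\in L^\infty(0,T;L^2(\Omega))\cap L^2(0,T;H^1(\Omega))$ be a Leray--Hopf weak solution to the incompressible Navier--Stokes equations with viscosity $\nu$ such that $D[u^\nu]\in\mathcal{M}_{\rm loc}(\Omega\times(0,T))$ is a non-negative measure. Assume $u^\nu\in L^q_{\rm loc}(0,T;L^r_{\rm loc}(\Omega))$ and $p^\nu\in L^{q/2}_{\rm loc}(0,T;L^{r/2}_{\rm loc}(\Omega))$ for some $q,r\ge3$ such that $\frac2q+\frac dr\ge1$ and $$s=d+1-3\left(\frac dr+\frac2q\right)\ge0.$$ Then $D[u^\nu]\ll\mathcal{P}^s$ and, if $D[u^\nu]$ is non-trivial and concentrated on a space-time set $S$, then $$\dim_{\mathcal{P}}S\ge s.$$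
   Context: Navier--Stokes equations: $\partial_tu^\nu+(u^\nu\cdot\nabla)u^\nu=-\nabla p^\nu+\nu\Delta u^\nu$, $\operatorname{div}u^\nu=0$ in $\Omega\times(0,T)$, with no-slip condition $u^\nu=0$ on $\partial\Omega\times(0,T)$ if $\Omega$ has a boundary (boundaries are assumed smooth). A Leray--Hopf weak solution is a distributional solution in $L^\infty(0,T;L^2(\Omega))\cap L^2(0,T;H^1(\Omega))$ (with zero trace if there is a boundary) attaining an $L^2$ divergence-free initial datum and satisfying the global energy inequality; $p^\nu$ is the associated pressure. Dissipation distribution: $D[u^\nu]$ is the distribution on $\Omega\times(0,T)$ defined by the local energy identity $$\partial_t\frac{|u^\nu|^2}{2}+\operatorname{div}\Big(\Big(\frac{|u^\nu|^2}{2}+p^\nu\Big)u^\nu\Big)-\nu\Delta\frac{|u^\nu|^2}{2}=-D[u^\nu]-\nu|\nabla u^\nu|^2 .$$ $\mathcal{M}_{\rm loc}(X)$ denotes locally finite Borel (Radon) measures on $X$. Parabolic Hausdorff measure: for $\delta>0$ let $\mathcal{C}^2_\delta(x,t)=B_\delta(x)\times(t-\delta^2,t+\delta^2)$. Then $\mathcal{P}^s(A)=\lim_{\rho\to0^+}\inf\{\sum_ir_i^s\}$, the infimum over at most countable covers $\{\mathcal{C}^2_{r_i}(x_i,t_i)\}_i$ of $A\subset\mathbb{R}^d\times\mathbb{R}$ by such cylinders of diameter $\le\rho$, and $\dim_{\mathcal{P}}(A)=\inf\{s\ge0:\mathcal{P}^s(A)=0\}$. A measure $\mu$ is concentrated on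 a (Borel) set $S$ if $\mu(A)=\mu(A\cap S)$ for all measurable $A$. $\mu\ll\mathcal{P}^s$ means $\mathcal{P}^s(A)=0\Rightarrow\mu(A)=0$ for Borel $A\subset\Omega\times(0,T)$. *)

theory Defs
  imports "HOL-Analysis.Analysis" "HOL-Probability.Essential_Supremum"
begin

section \<open>Smooth functions, test functions, domains\<close>

definition pderiv_dir :: "'a::euclidean_space \<Rightarrow> ('a \<Rightarrow> 'b::real_normed_vector) \<Rightarrow> 'a \<Rightarrow> 'b"
  where "pderiv_dir b f x = frechet_derivative f (at x) b"

text \<open>\<open>Ck_on\<close> and \<open>smooth_on\<close> are meant for open \<open>U\<close>.\<close>

primrec Ck_on :: "nat \<Rightarrow> ('a::euclidean_space \<Rightarrow> 'b::real_normed_vector) \<Rightarrow> 'a set \<Rightarrow> bool"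
  where
    "Ck_on 0 f U \<longleftrightarrow> continuous_on U f"
  | "Ck_on (Suc k) f U \<longleftrightarrow>
       (\<forall>x\<in>U. f differentiable (at x)) \<and> (\<forall>b\<in>Basis. Ck_on k (pderiv_dir b f) U)"

definition smooth_on :: "('a::euclidean_space \<Rightarrow> 'b::real_normed_vector) \<Rightarrow> 'a set \<Rightarrow> bool"
  where "smooth_on f U \<longleftrightarrow> (\<forall>k. Ck_on k f U)"

definition test_functions :: "'a::euclidean_space set \<Rightarrow> ('a \<Rightarrow> 'b::real_normed_vector) set"
  where "test_functions W =
    {\<phi>. smooth_on \<phi> UNIV \<and> compact (closure {x. \<phi> x \<noteq> 0}) \<and> closure {x. \<phi> x \<noteq> 0} \<subseteq> W}"

text \<open>Every boundary point has a neighbourhood in which the set is the sublevel set of a smooth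
  function without critical points. The condition is void if the boundary is empty.\<close>

definition smooth_boundary :: "'a::euclidean_space set \<Rightarrow> bool"
  where "smooth_boundary \<Omega> \<longleftrightarrow>
    (\<forall>x\<in>frontier \<Omega>. \<exists>U (\<rho>::'a \<Rightarrow> real). open U \<and> x \<in> U \<and> smooth_on \<rho> U \<and>
       (\<forall>y\<in>U. frechet_derivative \<rho> (at y) \<noteq> (\<lambda>_. 0)) \<and> \<Omega> \<inter> U = {y\<in>U. \<rho> y < 0})"

definition smooth_domain :: "'a::euclidean_space set \<Rightarrow> bool"
  where "smooth_domain \<Omega> \<longleftrightarrow> open \<Omega> \<and> connected \<Omega> \<and> \<Omega> \<noteq> {} \<and> smooth_boundary \<Omega>"


section \<open>Lebesgue and Bochner spaces\<close>

definition ennreal_powr :: "ennreal \<Rightarrow> real \<Rightarrow> ennreal"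
  where "ennreal_powr x a = (if x = \<infinity> then \<infinity> else ennreal (enn2real x powr a))"

definition Lp_norm :: "'a measure \<Rightarrow> ennreal \<Rightarrow> ('a \<Rightarrow> ennreal) \<Rightarrow> ennreal"
  where "Lp_norm M q F =
    (if q = \<infinity> then esssup M F
     else ennreal_powr (\<integral>\<^sup>+ x. ennreal_powr (F x) (enn2real q) \<partial>M) (1 / enn2real q))"

definition L2_fun :: "'a::euclidean_space set \<Rightarrow> ('a \<Rightarrow> 'b::euclidean_space) \<Rightarrow> bool"
  where "L2_fun K f \<longleftrightarrow> f \<in> borel_measurable (lebesgue_on K) \<and>
    Lp_norm (lebesgue_on K) 2 (\<lambda>x. ennreal (norm (f x))) < \<infinity>"

definition locally_integrable ::
    "'a::euclidean_space set \<Rightarrow> ('a \<Rightarrow> 'b::euclidean_space) \<Rightarrow> bool"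
  where "locally_integrable W f \<longleftrightarrow>
    (\<forall>K. compact K \<and> K \<subseteq> W \<longrightarrow> integrable (lebesgue_on K) f)"

text \<open>\<open>f \<in> L\<^sup>q(I; L\<^sup>r(K))\<close> for \<open>f\<close> given as a function of \<open>(x, t)\<close>. The exponents
  may be infinite.\<close>

definition Lq_Lr :: "ennreal \<Rightarrow> ennreal \<Rightarrow> real set \<Rightarrow> 'a::euclidean_space set \<Rightarrow>
    ('a \<times> real \<Rightarrow> 'b::euclidean_space) \<Rightarrow> bool"
  where "Lq_Lr q r I K f \<longleftrightarrow> f \<in> borel_measurable (lebesgue_on (K \<times> I)) \<and>
    Lp_norm (lebesgue_on I) q
      (\<lambda>t. Lp_norm (lebesgue_on K) r (\<lambda>x. ennreal (norm (f (x, t))))) < \<infinity>"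

definition Lq_Lr_loc :: "ennreal \<Rightarrow> ennreal \<Rightarrow> real set \<Rightarrow> 'a::euclidean_space set \<Rightarrow>
    ('a \<times> real \<Rightarrow> 'b::euclidean_space) \<Rightarrow> bool"
  where "Lq_Lr_loc q r J \<Omega> f \<longleftrightarrow>
    (\<forall>I K. compact I \<and> I \<subseteq> J \<and> compact K \<and> K \<subseteq> \<Omega> \<longrightarrow> Lq_Lr q r I K f)"


section \<open>Weak gradients and Sobolev spaces\<close>

text \<open>The \<open>(i, j)\<close> entry of the gradient is the \<open>j\<close>-th partial derivative of the \<open>i\<close>-th component,
  as for \<^const>\<open>jacobian\<close>; the norm of a matrix is its Frobenius norm.\<close>

definition weak_gradient ::
    "(real^'n) set \<Rightarrow> (real^'n \<Rightarrow> real^'n) \<Rightarrow> (real^'n \<Rightarrow> real^'n^'n) \<Rightarrow> bool"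
  where "weak_gradient \<Omega> f g \<longleftrightarrow> locally_integrable \<Omega> f \<and> locally_integrable \<Omega> g \<and>
    (\<forall>\<phi>\<in>test_functions \<Omega>. \<forall>i j.
       (LINT x|lebesgue_on \<Omega>. f x $ i * pderiv_dir (axis j 1) \<phi> x) =
       - (LINT x|lebesgue_on \<Omega>. g x $ i $ j * (\<phi> x :: real)))"

text \<open>\<open>H\<^sup>1\<close> functions of zero trace: the closure of the test functions in the \<open>H\<^sup>1\<close> norm.\<close>

definition H1_zero_trace :: "(real^'n) set \<Rightarrow> (real^'n \<Rightarrow> real^'n) \<Rightarrow> bool"
  where "H1_zero_trace \<Omega> f \<longleftrightarrow> L2_fun \<Omega> f \<and>
    (\<exists>g. L2_fun \<Omega> g \<and> weak_gradient \<Omega> f g \<and>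
      (\<exists>\<psi>. (\<forall>k. \<psi> k \<in> test_functions \<Omega>) \<and>
        (\<lambda>k::nat. Lp_norm (lebesgue_on \<Omega>) 2 (\<lambda>x. ennreal (norm (\<psi> k x - f x)))) \<longlonglongrightarrow> 0 \<and>
        (\<lambda>k. Lp_norm (lebesgue_on \<Omega>) 2 (\<lambda>x. ennreal (norm (jacobian (\<psi> k) (at x) - g x))))
          \<longlonglongrightarrow> 0))"

text \<open>\<open>u \<in> L\<^sup>2(0,T; H\<^sup>1(\<Omega>))\<close> with spatial weak gradient \<open>G\<close>.\<close>

definition L2_H1_with_gradient :: "(real^'n) set \<Rightarrow> real \<Rightarrow> ((real^'n) \<times> real \<Rightarrow> real^'n) \<Rightarrow>
    ((real^'n) \<times> real \<Rightarrow> real^'n^'n) \<Rightarrow> bool"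
  where "L2_H1_with_gradient \<Omega> T u G \<longleftrightarrow>
    Lq_Lr 2 2 {0<..<T} \<Omega> u \<and> Lq_Lr 2 2 {0<..<T} \<Omega> G \<and>
    (AE t in lebesgue_on {0<..<T}. weak_gradient \<Omega> (\<lambda>x. u (x, t)) (\<lambda>x. G (x, t)))"

text \<open>A representative of the spatial weak gradient; it is unique almost everywhere.\<close>

definition spatial_grad :: "(real^'n) set \<Rightarrow> real \<Rightarrow> ((real^'n) \<times> real \<Rightarrow> real^'n) \<Rightarrow>
    (real^'n) \<times> real \<Rightarrow> real^'n^'n"
  where "spatial_grad \<Omega> T u = (SOME G. L2_H1_with_gradient \<Omega> T u G)"


section \<open>Leray--Hopf solutions\<close>

definition dt :: "((real^'n) \<times> real \<Rightarrow> 'b::real_normed_vector) \<Rightarrow> (real^'n) \<times> real \<Rightarrow> 'b"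
  where "dt = pderiv_dir (0, 1)"

definition dx :: "'n \<Rightarrow> ((real^'n) \<times> real \<Rightarrow> 'b::real_normed_vector) \<Rightarrow> (real^'n) \<times> real \<Rightarrow> 'b"
  where "dx i = pderiv_dir (axis i 1, 0)"

definition grad_x :: "((real^'n) \<times> real \<Rightarrow> real) \<Rightarrow> (real^'n) \<times> real \<Rightarrow> real^'n"
  where "grad_x \<phi> z = (\<chi> i. dx i \<phi> z)"

definition div_x :: "((real^'n) \<times> real \<Rightarrow> real^'n) \<Rightarrow> (real^'n) \<times> real \<Rightarrow> real"
  where "div_x \<psi> z = (\<Sum>i\<in>UNIV. dx i \<psi> z $ i)"

definition lap_x ::
    "((real^'n) \<times> real \<Rightarrow> 'b::real_normed_vector) \<Rightarrow> (real^'n) \<times> real \<Rightarrow> 'b"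
  where "lap_x \<psi> z = (\<Sum>i\<in>UNIV. dx i (dx i \<psi>) z)"

text \<open>The pairing of \<open>- \<partial>\<^sub>t u - div (u \<otimes> u) + \<nu> \<Delta> u\<close> with \<open>\<psi>\<close>, all derivatives moved to \<open>\<psi>\<close>.\<close>

definition momentum_pairing :: "(real^'n) set \<Rightarrow> real \<Rightarrow> real \<Rightarrow> ((real^'n) \<times> real \<Rightarrow> real^'n) \<Rightarrow>
    ((real^'n) \<times> real \<Rightarrow> real^'n) \<Rightarrow> real"
  where "momentum_pairing \<Omega> T \<nu> u \<psi> = (LINT z|lebesgue_on (\<Omega> \<times> {0<..<T}).
      u z \<bullet> dt \<psi> z + (\<Sum>j\<in>UNIV. u z $ j * (u z \<bullet> dx j \<psi> z)) + \<nu> * (u z \<bullet> lap_x \<psi> z))"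

definition weakly_div_free :: "(real^'n) set \<Rightarrow> (real^'n \<Rightarrow> real^'n) \<Rightarrow> bool"
  where "weakly_div_free \<Omega> f \<longleftrightarrow> (\<forall>\<phi>\<in>test_functions \<Omega>.
      (LINT x|lebesgue_on \<Omega>. (\<Sum>i\<in>UNIV. f x $ i * pderiv_dir (axis i 1) \<phi> x)) = (0::real))"

text \<open>As \<open>u\<close> is only defined up to null sets, the energy inequality is required for almost every
  time and the initial datum is attained, in \<open>L\<^sup>2\<close>, along times outside a null set.\<close>

definition leray_hopf :: "(real^'n) set \<Rightarrow> real \<Rightarrow> real \<Rightarrow> ((real^'n) \<times> real \<Rightarrow> real^'n) \<Rightarrow> bool"
  where "leray_hopf \<Omega> T \<nu> u \<longleftrightarrow>
    Lq_Lr \<infinity> 2 {0<..<T} \<Omega> u \<and>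
    (\<exists>G. L2_H1_with_gradient \<Omega> T u G) \<and>
    (frontier \<Omega> \<noteq> {} \<longrightarrow>
      (AE t in lebesgue_on {0<..<T}. H1_zero_trace \<Omega> (\<lambda>x. u (x, t)))) \<and>
    (\<forall>\<phi>\<in>test_functions (\<Omega> \<times> {0<..<T}).
      (LINT z|lebesgue_on (\<Omega> \<times> {0<..<T}). u z \<bullet> grad_x \<phi> z) = 0) \<and>
    (\<forall>\<psi>\<in>test_functions (\<Omega> \<times> {0<..<T}).
      (\<forall>z. div_x \<psi> z = 0) \<longrightarrow> momentum_pairing \<Omega> T \<nu> u \<psi> = 0) \<and>
    (\<exists>u0. L2_fun \<Omega> u0 \<and> weakly_div_free \<Omega> u0 \<and>
      (\<exists>N\<in>null_sets lebesgue.
        ((\<lambda>t. Lp_norm (lebesgue_on \<Omega>) 2 (\<lambda>x. ennreal (norm (u (x, t) - u0 x)))) \<longlongrightarrow> 0)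
          (at 0 within ({0<..<T} - N))) \<and>
      (AE t in lebesgue_on {0<..<T}.
        (\<integral>\<^sup>+ x. ennreal ((norm (u (x, t)))\<^sup>2) \<partial>lebesgue_on \<Omega>) / 2 +
        ennreal \<nu> * (\<integral>\<^sup>+ z. ennreal ((norm (spatial_grad \<Omega> T u z))\<^sup>2) \<partial>lebesgue_on (\<Omega> \<times> {0<..<t}))
        \<le> (\<integral>\<^sup>+ x. ennreal ((norm (u0 x))\<^sup>2) \<partial>lebesgue_on \<Omega>) / 2))"

text \<open>The pressure is only determined up to a function of time; any choice is admitted.\<close>

definition associated_pressure :: "(real^'n) set \<Rightarrow> real \<Rightarrow> real \<Rightarrow>
    ((real^'n) \<times> real \<Rightarrow> real^'n) \<Rightarrow> ((real^'n) \<times> real \<Rightarrow> real) \<Rightarrow> bool"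
  where "associated_pressure \<Omega> T \<nu> u p \<longleftrightarrow> locally_integrable (\<Omega> \<times> {0<..<T}) p \<and>
    (\<forall>\<psi>\<in>test_functions (\<Omega> \<times> {0<..<T}).
      momentum_pairing \<Omega> T \<nu> u \<psi> +
        (LINT z|lebesgue_on (\<Omega> \<times> {0<..<T}). p z * div_x \<psi> z) = 0)"

text \<open>The distribution \<open>D[u]\<close>, evaluated at a test function on \<open>\<Omega> \<times> (0,T)\<close>: the local energy
  identity solved for \<open>D[u]\<close>, with all derivatives of products moved to \<open>\<phi>\<close>. It is meaningful
  when \<open>\<bar>u\<bar>\<^sup>3\<close> and \<open>p u\<close> are locally integrable.\<close>

definition dissipation :: "(real^'n) set \<Rightarrow> real \<Rightarrow> real \<Rightarrow> ((real^'n) \<times> real \<Rightarrow> real^'n) \<Rightarrow>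
    ((real^'n) \<times> real \<Rightarrow> real) \<Rightarrow> ((real^'n) \<times> real \<Rightarrow> real) \<Rightarrow> real"
  where "dissipation \<Omega> T \<nu> u p \<phi> = (LINT z|lebesgue_on (\<Omega> \<times> {0<..<T}).
      (norm (u z))\<^sup>2 / 2 * dt \<phi> z
      + ((norm (u z))\<^sup>2 / 2 + p z) * (u z \<bullet> grad_x \<phi> z)
      + \<nu> * ((norm (u z))\<^sup>2 / 2) * lap_x \<phi> z
      - \<nu> * (norm (spatial_grad \<Omega> T u z))\<^sup>2 * \<phi> z)"


section \<open>Measures\<close>

definition locally_finite_borel_on :: "'a::euclidean_space set \<Rightarrow> 'a measure \<Rightarrow> bool"
  where "locally_finite_borel_on W \<mu> \<longleftrightarrow> sets \<mu> = sets (restrict_space borel W) \<and>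
    (\<forall>K. compact K \<and> K \<subseteq> W \<longrightarrow> emeasure \<mu> K < \<infinity>)"

text \<open>The distribution \<open>D\<close> on \<open>W\<close> is the non-negative measure \<open>\<mu>\<close>.\<close>

definition distribution_is_measure ::
    "'a::euclidean_space set \<Rightarrow> (('a \<Rightarrow> real) \<Rightarrow> real) \<Rightarrow> 'a measure \<Rightarrow> bool"
  where "distribution_is_measure W D \<mu> \<longleftrightarrow> locally_finite_borel_on W \<mu> \<and>
    (\<forall>\<phi>\<in>test_functions W. D \<phi> = (LINT z|\<mu>. \<phi> z))"

definition concentrated_on :: "'a measure \<Rightarrow> 'a set \<Rightarrow> bool"
  where "concentrated_on \<mu> S \<longleftrightarrow> (\<forall>A\<in>sets \<mu>. emeasure \<mu> A = emeasure \<mu> (A \<inter> S))"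


section \<open>Parabolic Hausdorff measure and dimension\<close>

definition parabolic_cylinder :: "real \<Rightarrow> 'a::euclidean_space \<Rightarrow> real \<Rightarrow> ('a \<times> real) set"
  where "parabolic_cylinder \<delta> x t = ball x \<delta> \<times> {t - \<delta>\<^sup>2<..<t + \<delta>\<^sup>2}"

definition parabolic_premeasure ::
    "real \<Rightarrow> real \<Rightarrow> ('a::euclidean_space \<times> real) set \<Rightarrow> ennreal"
  where "parabolic_premeasure s \<rho> A =
    Inf {(\<Sum>\<^sub>\<infinity>i\<in>I. ennreal (r i powr s)) | (I::nat set) r x t.
      (\<forall>i\<in>I. r i > 0 \<and> diameter (parabolic_cylinder (r i) (x i) (t i)) \<le> \<rho>) \<and>
      A \<subseteq> (\<Union>i\<in>I. parabolic_cylinder (r i) (x i) (t i))}"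

definition parabolic_measure :: "real \<Rightarrow> ('a::euclidean_space \<times> real) set \<Rightarrow> ennreal"
  where "parabolic_measure s A = Lim (at_right 0) (\<lambda>\<rho>. parabolic_premeasure s \<rho> A)"

definition parabolic_dim :: "('a::euclidean_space \<times> real) set \<Rightarrow> ereal"
  where "parabolic_dim A = Inf {ereal s | s. 0 \<le> s \<and> parabolic_measure s A = 0}"

end

theory Submission
  imports Defs "HOL-Computational_Algebra.Polynomial"
begin

text \<open>
  Write \<open>\<sigma> = d / r + 2 / q\<close>, so that \<open>s = d + 1 - 3\<sigma>\<close>. The heart of the matter is the growth bound
  \<open>\<mu>(C) \<le> C' \<delta>\<^sup>s\<close> for all parabolic cylinders \<open>C\<close> of small radius \<open>\<delta>\<close> near a given
  space-time point (\<open>dissipation_parabolic_growth\<close>); the theorem then follows from a covering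
  argument, as for any measure with such a growth.

  For the growth bound, test the local energy identity with a cutoff \<open>\<phi> \<ge> 0\<close> that is at least 1 on
  the cylinder, vanishes off the cylinder of twice the size (that is, off
  \<open>cball x (2\<delta>) \<times> cball t (2\<delta>\<^sup>2)\<close>), and has parabolic scaling:
  \<open>\<bar>\<partial>\<^sub>t \<phi>\<bar>\<close> and \<open>\<bar>\<Delta>\<phi>\<bar>\<close> are of order \<open>\<delta>\<^sup>-\<^sup>2\<close>, \<open>\<bar>\<nabla>\<phi>\<bar>\<close> of order \<open>\<delta>\<^sup>-\<^sup>1\<close>
  (\<open>parabolic_cutoff\<close>). The viscous term \<open>-\<nu>\<bar>\<nabla>u\<bar>\<^sup>2\<phi>\<close> has a good sign and is dropped. By
  Young's inequality for \<open>\<bar>p\<bar>\<bar>u\<bar>\<close>, what is left is at most a constant times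
  \<open>\<delta>\<^sup>-\<^sup>2 \<integral>\<bar>u\<bar>\<^sup>2 + \<delta>\<^sup>-\<^sup>1 \<integral>(\<bar>u\<bar>\<^sup>3 + \<bar>p\<bar>\<^sup>3\<^sup>/\<^sup>2)\<close> over the doubled cylinder
  (\<open>dissipation_le_local_norms\<close>). Hoelder's inequality, in space and then in time, bounds the
  integral of \<open>\<bar>f\<bar>\<^sup>a\<close> over a cylinder by a constant times
  \<open>\<delta>\<close> to the power \<open>d(1 - a/r) + 2(1 - a/q)\<close> (\<open>Lq_Lr_parabolic_scaling\<close>). For the cubic terms
  this power is \<open>d + 2 - 3\<sigma> = s + 1\<close>, for the pressure as well because its exponents are halved; for
  the quadratic term it is \<open>d + 2 - 2\<sigma>\<close>, which is at least \<open>s + 2\<close> exactly when \<open>\<sigma> \<ge> 1\<close>.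

  If \<open>A\<close> is a null set of the parabolic measure, it has covers by cylinders of small radii \<open>r\<^sub>i\<close>
  with \<open>\<Sum>r\<^sub>i\<^sup>s\<close> arbitrarily small, and the growth bound gives \<open>\<mu>(A) = 0\<close>, first near
  each point (\<open>emeasure_eq_0_if_parabolic_measure_eq_0\<close>) and then globally by the Lindeloef
  property. If \<open>\<mu>\<close> is concentrated on \<open>S\<close> and the dimension of \<open>S\<close> were less than \<open>s\<close>, then \<open>S\<close>
  would be null for the parabolic measure of exponent \<open>s\<close>, and \<open>\<mu>\<close> would vanish.
\<close>

section \<open>Smooth cutoff functions with parabolic scaling\<close>

text \<open>The functions \<open>p(1/s) exp(-1/s)\<close>, extended by 0: the family is closed under differentiation,
  so that smoothness can be proved by one induction that treats all of its members at once.\<close>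

definition flat :: "real poly \<Rightarrow> real \<Rightarrow> real"
  where "flat p s = (if s > 0 then poly p (1 / s) * exp (- (1 / s)) else 0)"

definition flat_deriv_poly :: "real poly \<Rightarrow> real poly"
  where "flat_deriv_poly p = monom 1 2 * (p - pderiv p)"

lemma flat_nonpos [simp]: "s \<le> 0 \<Longrightarrow> flat p s = 0"
  by (simp add: flat_def)

lemma poly_times_exp_minus_tendsto_0:
  fixes p :: "real poly"
  shows "((\<lambda>y. poly p y * exp (- y)) \<longlongrightarrow> 0) at_top"
proof -
  have "((\<lambda>y. \<Sum>i\<le>degree p. coeff p i * (y ^ i / exp y)) \<longlongrightarrow> (\<Sum>i\<le>degree p. coeff p i * 0)) at_top"
    by (intro tendsto_sum tendsto_mult tendsto_const tendsto_power_div_exp_0)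
  moreover have "(\<Sum>i\<le>degree p. coeff p i * (y ^ i / exp y)) = poly p y * exp (- y)" for y
    by (simp add: poly_altdef sum_distrib_right exp_minus divide_inverse mult.assoc)
  ultimately show ?thesis by simp
qed

lemma flat_tendsto_0: "(flat p \<longlongrightarrow> 0) (at 0)"
proof -
  have "filterlim (\<lambda>s::real. 1 / s) at_top (at_right 0)"
    using filterlim_inverse_at_top_right by (simp add: inverse_eq_divide)
  from filterlim_compose[OF poly_times_exp_minus_tendsto_0 this]
  have "((\<lambda>s. poly p (1 / s) * exp (- (1 / s))) \<longlongrightarrow> 0) (at_right 0)" .
  then have r: "(flat p \<longlongrightarrow> 0) (at_right 0)"
    by (rule tendsto_cong[THEN iffD1, rotated])
       (auto simp: flat_def eventually_at_filter)
  have l: "(flat p \<longlongrightarrow> 0) (at_left 0)"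
    by (rule tendsto_eventually) (auto simp: eventually_at_filter)
  show ?thesis using r l by (simp add: filterlim_split_at)
qed

text \<open>Away from the origin this is calculus. At the origin the difference quotient of the function
  for \<open>p\<close> is again a member of the family, for the polynomial \<open>y p(y)\<close>, hence tends to 0.\<close>

lemma flat_has_derivative:
  "(flat p has_real_derivative flat (flat_deriv_poly p) s) (at s)"
proof -
  consider "s > 0" | "s < 0" | "s = 0" by linarith
  then show ?thesis
  proof cases
    case 1
    have "((\<lambda>s. poly p (1 / s) * exp (- (1 / s))) has_real_derivative flat (flat_deriv_poly p) s) (at s)"
      using 1 by (auto intro!: derivative_eq_intros
          simp: flat_def flat_deriv_poly_def poly_monom power2_eq_square field_simps)
    moreover have "eventually (\<lambda>x. poly p (1 / x) * exp (- (1 / x)) = flat p x) (nhds s)"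
      by (rule eventually_nhds_in_open[THEN eventually_mono, of "{0<..}"]) (use 1 in \<open>auto simp: flat_def\<close>)
    ultimately show ?thesis
      by (subst DERIV_cong_ev[OF refl _ refl, symmetric]) (auto elim: eventually_mono)
  next
    case 2
    have "eventually (\<lambda>x. flat p x = 0) (nhds s)"
      by (rule eventually_nhds_in_open[THEN eventually_mono, of "{..<0}"]) (use 2 in auto)
    then have "(flat p has_real_derivative 0) (at s)"
      by (subst DERIV_cong_ev[OF refl _ refl]) auto
    then show ?thesis using 2 by simp
  next
    case 3
    have eq: "flat (pCons 0 p) y = flat p y / y" for y
      by (auto simp: flat_def)
    have "((\<lambda>y. (flat p y - flat p 0) / (y - 0)) \<longlongrightarrow> 0) (at 0)"
      using flat_tendsto_0[of "pCons 0 p"] by (simp add: eq[abs_def])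
    then show ?thesis using 3 by (simp add: has_field_derivative_iff)
  qed
qed

lemma flat_bounded: "\<exists>B>0. \<forall>s\<le>b. \<bar>flat p s\<bar> \<le> B"
proof -
  have "continuous_on {0..b} (flat p)"
    by (meson DERIV_isCont continuous_at_imp_continuous_on flat_has_derivative)
  then have "bounded (flat p ` {0..b})"
    by (intro compact_imp_bounded compact_continuous_image) auto
  then obtain B where "B > 0" "\<And>s. s \<in> {0..b} \<Longrightarrow> \<bar>flat p s\<bar> \<le> B"
    by (auto simp: bounded_pos)
  then show ?thesis
    by (intro exI[of _ B]) (metis abs_zero atLeastAtMost_iff flat_nonpos less_eq_real_def linear)
qed

lemma pderiv_dir_eq: "(f has_derivative f') (at x) \<Longrightarrow> pderiv_dir b f x = f' b"
  by (simp add: pderiv_dir_def frechet_derivative_at[symmetric])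

lemma Ck_on_Suc_D: "Ck_on (Suc k) f U \<Longrightarrow> Ck_on k f U"
proof (induction k arbitrary: f)
  case 0
  then show ?case
    by (auto intro!: continuous_at_imp_continuous_on differentiable_imp_continuous_within)
next
  case (Suc k)
  then show ?case by (metis Ck_on.simps(2))
qed

lemma Ck_on_const: "Ck_on k (\<lambda>_. c) UNIV"
proof (induction k arbitrary: c)
  case (Suc k)
  have "pderiv_dir b (\<lambda>_. c) = (\<lambda>_::'a. 0)" for b
    by (rule ext, rule pderiv_dir_eq, rule has_derivative_const)
  with Suc show ?case by simp
qed simp

lemma Ck_on_add:
  assumes "Ck_on k f UNIV" "Ck_on k g UNIV"
  shows "Ck_on k (\<lambda>x. f x + g x) UNIV"
  using assms
proof (induction k arbitrary: f g)
  case 0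
  then show ?case by (auto intro: continuous_intros)
next
  case (Suc k)
  have "pderiv_dir b (\<lambda>x. f x + g x) = (\<lambda>x. pderiv_dir b f x + pderiv_dir b g x)" for b
  proof
    fix x show "pderiv_dir b (\<lambda>x. f x + g x) x = pderiv_dir b f x + pderiv_dir b g x"
      using has_derivative_add[of f "frechet_derivative f (at x)" "at x" g "frechet_derivative g (at x)"]
        Suc.prems
      by (subst pderiv_dir_eq) (auto simp: frechet_derivative_works pderiv_dir_def)
  qed
  with Suc show ?case by auto
qed

lemma Ck_on_mult:
  fixes f g :: "'a::euclidean_space \<Rightarrow> real"
  assumes "Ck_on k f UNIV" "Ck_on k g UNIV"
  shows "Ck_on k (\<lambda>x. f x * g x) UNIV"
  using assms
proof (induction k arbitrary: f g)
  case 0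
  then show ?case by (auto intro: continuous_intros)
next
  case (Suc k)
  have eq: "pderiv_dir b (\<lambda>x. f x * g x) = (\<lambda>x. f x * pderiv_dir b g x + pderiv_dir b f x * g x)" for b
  proof
    fix x show "pderiv_dir b (\<lambda>x. f x * g x) x = f x * pderiv_dir b g x + pderiv_dir b f x * g x"
      using has_derivative_mult[of f "frechet_derivative f (at x)" x UNIV g "frechet_derivative g (at x)"]
        Suc.prems
      by (subst pderiv_dir_eq) (auto simp: frechet_derivative_works pderiv_dir_def)
  qed
  show ?case
    unfolding Ck_on.simps eq
    using Suc.prems Suc.IH Ck_on_Suc_D[OF Suc.prems(1)] Ck_on_Suc_D[OF Suc.prems(2)]
    by (auto intro!: Ck_on_add)
qed

lemma pderiv_dir_flat_comp:
  assumes "P differentiable (at x)"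
  shows "(\<lambda>x. flat p (P x)) differentiable (at x)"
    and "pderiv_dir b (\<lambda>x. flat p (P x)) x = flat (flat_deriv_poly p) (P x) * pderiv_dir b P x"
proof -
  have "((\<lambda>x. flat p (P x)) has_derivative
      (\<lambda>h. flat (flat_deriv_poly p) (P x) * frechet_derivative P (at x) h)) (at x)"
    using has_derivative_compose[of P "frechet_derivative P (at x)" x UNIV "flat p"]
      flat_has_derivative[of p "P x"] assms
    by (simp add: frechet_derivative_works has_field_derivative_def)
  then show "(\<lambda>x. flat p (P x)) differentiable (at x)"
    "pderiv_dir b (\<lambda>x. flat p (P x)) x = flat (flat_deriv_poly p) (P x) * pderiv_dir b P x"
    by (auto simp: differentiable_def pderiv_dir_eq) (simp add: pderiv_dir_def)
qed

text \<open>A derivative of \<open>flat p (P x)\<close> is a product of a function of the same form, for another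
  polynomial, with a derivative of \<open>P\<close>; hence the induction on \<open>k\<close> must range over all \<open>p\<close>.\<close>

lemma Ck_on_flat_comp: "Ck_on k P UNIV \<Longrightarrow> Ck_on k (\<lambda>x. flat p (P x)) UNIV"
proof (induction k arbitrary: p)
  case 0
  have "continuous_on UNIV (flat p)"
    by (meson DERIV_isCont continuous_at_imp_continuous_on flat_has_derivative)
  with 0 show ?case
    by simp (metis continuous_on_compose2 subset_UNIV)
next
  case (Suc k)
  have d: "P differentiable (at x)" for x using Suc.prems by simp
  have eq: "pderiv_dir b (\<lambda>x. flat p (P x)) =
      (\<lambda>x. flat (flat_deriv_poly p) (P x) * pderiv_dir b P x)" for b
    using pderiv_dir_flat_comp[OF d] by auto
  show ?case
    unfolding Ck_on.simps eq
    using Suc.prems Suc.IH[OF Ck_on_Suc_D[OF Suc.prems]]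
    by (auto intro!: Ck_on_mult pderiv_dir_flat_comp(1)[OF d])
qed

text \<open>The square of the distance from \<open>(x, t)\<close> after the parabolic rescaling by \<open>\<delta>\<close> in space and
  \<open>\<delta>\<^sup>2\<close> in time. Being quadratic, it has an affine derivative and is trivially smooth.\<close>

definition parabolic_sq :: "real \<Rightarrow> 'a::euclidean_space \<Rightarrow> real \<Rightarrow> 'a \<times> real \<Rightarrow> real"
  where "parabolic_sq \<delta> x t z =
    ((fst z - x) \<bullet> (fst z - x)) / \<delta>\<^sup>2 + ((snd z - t) * (snd z - t)) / \<delta> ^ 4"

definition parabolic_sq_deriv :: "real \<Rightarrow> 'a::euclidean_space \<Rightarrow> real \<Rightarrow> 'a \<times> real \<Rightarrow> 'a \<times> real \<Rightarrow> real"
  where "parabolic_sq_deriv \<delta> x t b z =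
    2 * (fst b \<bullet> (fst z - x)) / \<delta>\<^sup>2 + 2 * (snd b * (snd z - t)) / \<delta> ^ 4"

lemma parabolic_sq_has_derivative:
  "(parabolic_sq \<delta> x t has_derivative (\<lambda>b. parabolic_sq_deriv \<delta> x t b z)) (at z)"
proof -
  have "((\<lambda>z. k * ((fst z - x) \<bullet> (fst z - x)) + l * ((snd z - t) * (snd z - t)))
      has_derivative (\<lambda>b. k * (2 * (fst b \<bullet> (fst z - x))) + l * (2 * (snd b * (snd z - t))))) (at z)"
    for k l
    by (rule derivative_eq_intros refl | simp)+
      (simp add: fun_eq_iff inner_commute algebra_simps)
  from this[of "inverse (\<delta>\<^sup>2)" "inverse (\<delta> ^ 4)"] show ?thesis
    by (simp add: parabolic_sq_def[abs_def] parabolic_sq_deriv_def divide_inverse mult.commute)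
qed

lemma parabolic_sq_deriv_has_derivative:
  "(parabolic_sq_deriv \<delta> x t b has_derivative
     (\<lambda>c. 2 * (fst b \<bullet> fst c) / \<delta>\<^sup>2 + 2 * (snd b * snd c) / \<delta> ^ 4)) (at z)"
proof -
  have "((\<lambda>z. k * (2 * (fst b \<bullet> (fst z - x))) + l * (2 * (snd b * (snd z - t)))) has_derivative
     (\<lambda>c. k * (2 * (fst b \<bullet> fst c)) + l * (2 * (snd b * snd c)))) (at z)" for k l
    by (rule derivative_eq_intros refl | simp)+
  from this[of "inverse (\<delta>\<^sup>2)" "inverse (\<delta> ^ 4)"] show ?thesis
    by (simp add: parabolic_sq_deriv_def[abs_def] divide_inverse mult.commute)
qed

lemma Ck_on_parabolic_sq: "Ck_on k (\<lambda>z. 4 - parabolic_sq \<delta> x t z) UNIV"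
proof -
  have d: "((\<lambda>z. 4 - parabolic_sq \<delta> x t z) has_derivative
      (\<lambda>b. - parabolic_sq_deriv \<delta> x t b z)) (at z)" for z
    by (rule derivative_eq_intros parabolic_sq_has_derivative refl | simp)+
  have e: "((\<lambda>z. - parabolic_sq_deriv \<delta> x t b z) has_derivative
      (\<lambda>c. - (2 * (fst b \<bullet> fst c) / \<delta>\<^sup>2 + 2 * (snd b * snd c) / \<delta> ^ 4))) (at z)" for b z
    by (rule has_derivative_minus parabolic_sq_deriv_has_derivative)+
  have eq: "pderiv_dir b (\<lambda>z. 4 - parabolic_sq \<delta> x t z) = (\<lambda>z. - parabolic_sq_deriv \<delta> x t b z)" for b
    by (rule ext) (rule pderiv_dir_eq[OF d])
  have "pderiv_dir c (\<lambda>z. - parabolic_sq_deriv \<delta> x t b z) =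
     (\<lambda>z. - (2 * (fst b \<bullet> fst c) / \<delta>\<^sup>2 + 2 * (snd b * snd c) / \<delta> ^ 4))" for b c
    by (rule ext) (rule pderiv_dir_eq[OF e])
  then have "Ck_on (Suc (Suc k)) (\<lambda>z. 4 - parabolic_sq \<delta> x t z) UNIV"
    by (simp add: eq Ck_on_const differentiableI[OF d] differentiableI[OF e])
  then show "Ck_on k (\<lambda>z. 4 - parabolic_sq \<delta> x t z) UNIV"
    by (blast dest: Ck_on_Suc_D)
qed

lemma pderiv_dir_bump:
  fixes x :: "'a::euclidean_space" and \<delta> t c :: real and p :: "real poly"
  defines "\<phi> \<equiv> \<lambda>z. flat p (4 - parabolic_sq \<delta> x t z) * c"
  shows "pderiv_dir b \<phi> z =
      - flat (flat_deriv_poly p) (4 - parabolic_sq \<delta> x t z) * parabolic_sq_deriv \<delta> x t b z * c"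
    and "pderiv_dir b (pderiv_dir b \<phi>) z =
      (flat (flat_deriv_poly (flat_deriv_poly p)) (4 - parabolic_sq \<delta> x t z) *
         (parabolic_sq_deriv \<delta> x t b z)\<^sup>2
       - flat (flat_deriv_poly p) (4 - parabolic_sq \<delta> x t z) *
         (2 * (fst b \<bullet> fst b) / \<delta>\<^sup>2 + 2 * (snd b * snd b) / \<delta> ^ 4)) * c"
    and "smooth_on \<phi> UNIV"
proof -
  let ?P = "\<lambda>z. 4 - parabolic_sq \<delta> x t z"
  have h: "((\<lambda>z. flat p (?P z)) has_derivative
      (\<lambda>b. - flat (flat_deriv_poly p) (?P z) * parabolic_sq_deriv \<delta> x t b z)) (at z)" for p z
  proof -
    have P: "(?P has_derivative (\<lambda>b. - parabolic_sq_deriv \<delta> x t b z)) (at z)"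
      by (rule derivative_eq_intros parabolic_sq_has_derivative refl | simp)+
    show ?thesis
      using has_derivative_compose[OF P flat_has_derivative[unfolded has_field_derivative_def]]
      by simp
  qed
  have 1: "pderiv_dir b \<phi> = (\<lambda>z. - (flat (flat_deriv_poly p) (?P z) * parabolic_sq_deriv \<delta> x t b z * c))"
    unfolding \<phi>_def
    by (rule ext) (simp add: pderiv_dir_eq[OF has_derivative_mult_left[OF h[of p], of c]])
  then show "pderiv_dir b \<phi> z = - flat (flat_deriv_poly p) (?P z) * parabolic_sq_deriv \<delta> x t b z * c"
    by simp
  have "((\<lambda>z. - (flat (flat_deriv_poly p) (?P z) * parabolic_sq_deriv \<delta> x t b z * c)) has_derivative
      (\<lambda>d. - ((flat (flat_deriv_poly p) (?P z) * (2 * (fst b \<bullet> fst d) / \<delta>\<^sup>2 + 2 * (snd b * snd d) / \<delta> ^ 4)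
        + (- flat (flat_deriv_poly (flat_deriv_poly p)) (?P z) * parabolic_sq_deriv \<delta> x t d z)
            * parabolic_sq_deriv \<delta> x t b z) * c))) (at z)"
    by (rule has_derivative_minus has_derivative_mult_left has_derivative_mult h
        parabolic_sq_deriv_has_derivative)+
  from pderiv_dir_eq[OF this, of b]
  show "pderiv_dir b (pderiv_dir b \<phi>) z =
      (flat (flat_deriv_poly (flat_deriv_poly p)) (?P z) * (parabolic_sq_deriv \<delta> x t b z)\<^sup>2
       - flat (flat_deriv_poly p) (?P z) *
         (2 * (fst b \<bullet> fst b) / \<delta>\<^sup>2 + 2 * (snd b * snd b) / \<delta> ^ 4)) * c"
    unfolding 1 by (simp add: power2_eq_square algebra_simps)
  show "smooth_on \<phi> UNIV"
    unfolding smooth_on_def \<phi>_def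
    by (intro allI Ck_on_mult Ck_on_const Ck_on_flat_comp Ck_on_parabolic_sq)
qed

text \<open>The cutoff is \<open>flat 1 (4 - Q) / flat 1 2\<close> with \<open>Q\<close> the rescaled squared distance. On the
  cylinder of radius \<open>\<delta>\<close> both terms of \<open>Q\<close> are at most 1, so the quotient is at least 1; it vanishes
  where \<open>Q \<ge> 4\<close>, in particular off the doubled cylinder. Each derivative in space costs a factor
  \<open>1 / \<delta>\<close> and the one in time a factor \<open>1 / \<delta>\<^sup>2\<close>, as \<open>Q\<close> is a function of \<open>(y - x) / \<delta>\<close> and
  \<open>(\<tau> - t) / \<delta>\<^sup>2\<close>.\<close>

lemma parabolic_cutoff:
  "\<exists>C>0. \<forall>x t \<delta>. \<delta> > 0 \<longrightarrow> (\<exists>\<phi> :: (real^'n) \<times> real \<Rightarrow> real.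
     smooth_on \<phi> UNIV \<and> (\<forall>z. 0 \<le> \<phi> z) \<and> (\<forall>z\<in>parabolic_cylinder \<delta> x t. 1 \<le> \<phi> z) \<and>
     (\<forall>z. z \<notin> cball x (2 * \<delta>) \<times> cball t (2 * \<delta>\<^sup>2) \<longrightarrow>
        \<phi> z = 0 \<and> dt \<phi> z = 0 \<and> grad_x \<phi> z = 0 \<and> lap_x \<phi> z = 0) \<and>
     (\<forall>z. \<bar>dt \<phi> z\<bar> \<le> C / \<delta>\<^sup>2 \<and> norm (grad_x \<phi> z) \<le> C / \<delta> \<and> \<bar>lap_x \<phi> z\<bar> \<le> C / \<delta>\<^sup>2))"
proof -
  let ?p1 = "flat_deriv_poly 1" let ?p2 = "flat_deriv_poly ?p1"
  obtain B1 where B1: "B1 > 0" "\<And>s. s \<le> 4 \<Longrightarrow> \<bar>flat ?p1 s\<bar> \<le> B1"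
    using flat_bounded by blast
  obtain B2 where B2: "B2 > 0" "\<And>s. s \<le> 4 \<Longrightarrow> \<bar>flat ?p2 s\<bar> \<le> B2"
    using flat_bounded by blast
  define c where "c = 1 / flat 1 2"
  have c: "c > 0" by (simp add: c_def flat_def)
  define C where "C = (4 * B1 + real CARD('n) * (4 * B1) + real CARD('n) * (16 * B2 + 2 * B1)) * c"
  have C: "4 * B1 * c \<le> C" "real CARD('n) * (4 * B1) * c \<le> C"
    "real CARD('n) * (16 * B2 + 2 * B1) * c \<le> C"
    using c B1(1) B2(1) by (auto simp: C_def)
  have "C > 0" using c B1(1) B2(1) by (auto simp: C_def intro!: mult_pos_pos add_pos_nonneg)
  \<comment> \<open>The derivatives of \<open>flat 1\<close> only enter at arguments \<open>4 - Q \<le> 4\<close>, where they are bounded.\<close>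
  moreover have "\<exists>\<phi> :: (real^'n) \<times> real \<Rightarrow> real.
     smooth_on \<phi> UNIV \<and> (\<forall>z. 0 \<le> \<phi> z) \<and> (\<forall>z\<in>parabolic_cylinder \<delta> x t. 1 \<le> \<phi> z) \<and>
     (\<forall>z. z \<notin> cball x (2 * \<delta>) \<times> cball t (2 * \<delta>\<^sup>2) \<longrightarrow>
        \<phi> z = 0 \<and> dt \<phi> z = 0 \<and> grad_x \<phi> z = 0 \<and> lap_x \<phi> z = 0) \<and>
     (\<forall>z. \<bar>dt \<phi> z\<bar> \<le> C / \<delta>\<^sup>2 \<and> norm (grad_x \<phi> z) \<le> C / \<delta> \<and> \<bar>lap_x \<phi> z\<bar> \<le> C / \<delta>\<^sup>2)"
    if \<delta>: "\<delta> > 0" for x t \<delta>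
  proof -
    let ?P = "\<lambda>z. 4 - parabolic_sq \<delta> x t z"
    let ?A = "parabolic_sq_deriv \<delta> x t"
    define \<phi> where "\<phi> = (\<lambda>z. flat 1 (?P z) * c)"
    have sq: "parabolic_sq \<delta> x t z = (norm (fst z - x) / \<delta>)\<^sup>2 + ((snd z - t) / \<delta>\<^sup>2)\<^sup>2" for z
      by (simp add: parabolic_sq_def power_divide power2_norm_eq_inner flip: power2_eq_square power_mult)
    have P4: "?P z \<le> 4" for z unfolding sq by simp
    have small: "norm (fst z - x) \<le> 2 * \<delta> \<and> \<bar>snd z - t\<bar> \<le> 2 * \<delta>\<^sup>2" if "?P z > 0" for z
    proof -
      have "a \<le> 2\<^sup>2 \<and> b \<le> 2\<^sup>2" if "0 < 4 - (a + b)" "0 \<le> a" "0 \<le> b" for a b :: real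
        using that by simp
      then have "(norm (fst z - x) / \<delta>)\<^sup>2 \<le> 2\<^sup>2" "((snd z - t) / \<delta>\<^sup>2)\<^sup>2 \<le> 2\<^sup>2"
        using that zero_le_power2 unfolding sq by blast+
      then have "norm (fst z - x) / \<delta> \<le> 2" "\<bar>(snd z - t) / \<delta>\<^sup>2\<bar> \<le> 2"
        using abs_le_square_iff[of "(snd z - t) / \<delta>\<^sup>2" 2]
        by (auto intro: power2_le_imp_le simp del: abs_divide)
      then show ?thesis using \<delta> by (auto simp: field_simps abs_divide)
    qed
    have D1: "pderiv_dir b \<phi> z = - flat ?p1 (?P z) * ?A b z * c" for b z
      unfolding \<phi>_def by (rule pderiv_dir_bump)
    have D2: "pderiv_dir b (pderiv_dir b \<phi>) z = (flat ?p2 (?P z) * (?A b z)\<^sup>2 -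
        flat ?p1 (?P z) * (2 * (fst b \<bullet> fst b) / \<delta>\<^sup>2 + 2 * (snd b * snd b) / \<delta> ^ 4)) * c" for b z
      unfolding \<phi>_def by (rule pderiv_dir_bump)
    have b1: "\<bar>pderiv_dir b \<phi> z\<bar> \<le> B1 * a * c" if "a \<ge> 0" "?P z > 0 \<Longrightarrow> \<bar>?A b z\<bar> \<le> a" for a b z
    proof (cases "?P z > 0")
      case True
      then have "\<bar>flat ?p1 (?P z)\<bar> * \<bar>?A b z\<bar> \<le> B1 * a"
        using that B1 P4 by (intro mult_mono) auto
      then show ?thesis using c by (simp add: D1 abs_mult mult_right_mono)
    next
      case False
      then show ?thesis using that(1) B1(1) c by (simp add: D1)
    qed
    have At: "\<bar>?A (0, 1) z\<bar> \<le> 4 / \<delta>\<^sup>2" if "?P z > 0" for z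
    proof -
      have "\<bar>snd z - t\<bar> \<le> 2 * \<delta>\<^sup>2" using small[OF that] by simp
      then have "\<bar>2 * (snd z - t) / \<delta> ^ 4\<bar> \<le> 4 * \<delta>\<^sup>2 / \<delta> ^ 4"
        using \<delta> by (simp add: abs_mult abs_divide divide_right_mono)
      also have "\<dots> = 4 / \<delta>\<^sup>2" using \<delta> by (simp add: power2_eq_square power4_eq_xxxx)
      finally show ?thesis by (simp add: parabolic_sq_deriv_def)
    qed
    have Ax: "\<bar>?A (axis i 1, 0) z\<bar> \<le> 4 / \<delta>" if "?P z > 0" for i z
    proof -
      have "\<bar>(fst z - x) $ i\<bar> \<le> 2 * \<delta>"
        using small[OF that] component_le_norm_cart[of "fst z - x" i] by linarith
      then have "\<bar>2 * (fst z - x) $ i / \<delta>\<^sup>2\<bar> \<le> 4 * \<delta> / \<delta>\<^sup>2"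
        using \<delta> by (simp add: abs_mult abs_divide divide_right_mono)
      also have "\<dots> = 4 / \<delta>" using \<delta> by (simp add: power2_eq_square)
      finally show ?thesis by (simp add: parabolic_sq_deriv_def inner_axis' cart_eq_inner_axis[symmetric])
    qed
    have "\<bar>dt \<phi> z\<bar> \<le> C / \<delta>\<^sup>2" for z
    proof -
      have "\<bar>dt \<phi> z\<bar> \<le> B1 * (4 / \<delta>\<^sup>2) * c"
        unfolding dt_def by (rule b1) (use At in auto)
      also have "\<dots> = 4 * B1 * c / \<delta>\<^sup>2" by simp
      also have "\<dots> \<le> C / \<delta>\<^sup>2" using C(1) by (simp add: divide_right_mono)
      finally show ?thesis .
    qed
    moreover have "norm (grad_x \<phi> z) \<le> C / \<delta>" for z
    proof -
      have "norm (grad_x \<phi> z) \<le> (\<Sum>i\<in>UNIV. \<bar>grad_x \<phi> z $ i\<bar>)" by (rule norm_le_l1_cart)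
      also have "\<dots> \<le> (\<Sum>i\<in>(UNIV::'n set). B1 * (4 / \<delta>) * c)"
      proof (rule sum_mono)
        fix i
        have "\<bar>pderiv_dir (axis i 1, 0) \<phi> z\<bar> \<le> B1 * (4 / \<delta>) * c"
          by (rule b1) (use \<delta> Ax in auto)
        then show "\<bar>grad_x \<phi> z $ i\<bar> \<le> B1 * (4 / \<delta>) * c" by (simp add: grad_x_def dx_def)
      qed
      also have "\<dots> = real CARD('n) * (4 * B1) * c / \<delta>" by simp
      also have "\<dots> \<le> C / \<delta>" using C(2) \<delta> by (simp add: divide_right_mono)
      finally show ?thesis .
    qed
    moreover have "\<bar>lap_x \<phi> z\<bar> \<le> C / \<delta>\<^sup>2" for z
    proof -
      have "\<bar>dx i (dx i \<phi>) z\<bar> \<le> (16 * B2 + 2 * B1) * c / \<delta>\<^sup>2" for i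
      proof (cases "?P z > 0")
        case True
        have sqb: "(?A (axis i 1, 0) z)\<^sup>2 \<le> 16 / \<delta>\<^sup>2"
          using power_mono[OF Ax[OF True, of i] abs_ge_zero, of 2] by (simp add: power_divide)
        have "\<bar>flat ?p2 (?P z) * (?A (axis i 1, 0) z)\<^sup>2 - flat ?p1 (?P z) * (2 / \<delta>\<^sup>2)\<bar>
          \<le> \<bar>flat ?p2 (?P z)\<bar> * (?A (axis i 1, 0) z)\<^sup>2 + \<bar>flat ?p1 (?P z)\<bar> * (2 / \<delta>\<^sup>2)"
          by (rule order_trans[OF abs_triangle_ineq4]) (simp add: abs_mult)
        also have "\<dots> \<le> B2 * (16 / \<delta>\<^sup>2) + B1 * (2 / \<delta>\<^sup>2)"
          using B1 B2 P4 sqb by (intro add_mono mult_mono) auto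
        also have "\<dots> = (16 * B2 + 2 * B1) / \<delta>\<^sup>2" by (simp add: add_divide_distrib mult.commute)
        finally have "\<bar>flat ?p2 (?P z) * (?A (axis i 1, 0) z)\<^sup>2 - flat ?p1 (?P z) * (2 / \<delta>\<^sup>2)\<bar> * c
          \<le> (16 * B2 + 2 * B1) / \<delta>\<^sup>2 * c" using c by (intro mult_right_mono) auto
        moreover have "dx i (dx i \<phi>) z =
            (flat ?p2 (?P z) * (?A (axis i 1, 0) z)\<^sup>2 - flat ?p1 (?P z) * (2 / \<delta>\<^sup>2)) * c"
          unfolding dx_def D2 by (simp add: inner_axis_axis)
        ultimately show ?thesis
          using c by (simp add: abs_mult)
      next
        case False
        then show ?thesis using B1(1) B2(1) c by (simp add: dx_def D2)
      qed
      then have "\<bar>lap_x \<phi> z\<bar> \<le> (\<Sum>i\<in>(UNIV::'n set). (16 * B2 + 2 * B1) * c / \<delta>\<^sup>2)"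
        unfolding lap_x_def by (intro order_trans[OF sum_abs] sum_mono) auto
      also have "\<dots> = real CARD('n) * (16 * B2 + 2 * B1) * c / \<delta>\<^sup>2" by simp
      also have "\<dots> \<le> C / \<delta>\<^sup>2" using C(3) by (simp add: divide_right_mono)
      finally show ?thesis .
    qed
    moreover have "smooth_on \<phi> UNIV" unfolding \<phi>_def by (rule pderiv_dir_bump)
    moreover have "0 \<le> \<phi> z" for z using c by (simp add: \<phi>_def flat_def)
    moreover have "1 \<le> \<phi> z" if "z \<in> parabolic_cylinder \<delta> x t" for z
    proof -
      have "norm (fst z - x) < \<delta>" "\<bar>snd z - t\<bar> < \<delta>\<^sup>2"
        using that by (auto simp: parabolic_cylinder_def dist_norm norm_minus_commute)
      then have "norm (fst z - x) / \<delta> \<le> 1" "\<bar>(snd z - t) / \<delta>\<^sup>2\<bar> \<le> 1"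
        using \<delta> by (auto simp: abs_divide)
      then have "(norm (fst z - x) / \<delta>)\<^sup>2 \<le> 1" "((snd z - t) / \<delta>\<^sup>2)\<^sup>2 \<le> 1"
        using \<delta> by (auto simp: abs_square_le_1 power_le_one)
      then have "2 \<le> ?P z" unfolding sq by linarith
      then have "flat 1 2 \<le> flat 1 (?P z)" by (auto simp: flat_def frac_le)
      then show ?thesis by (simp add: \<phi>_def c_def flat_def)
    qed
    moreover have "\<phi> z = 0 \<and> dt \<phi> z = 0 \<and> grad_x \<phi> z = 0 \<and> lap_x \<phi> z = 0"
      if "z \<notin> cball x (2 * \<delta>) \<times> cball t (2 * \<delta>\<^sup>2)" for z
    proof -
      have "\<not> ?P z > 0"
        using that small[of z] by (cases z) (auto simp: dist_norm norm_minus_commute)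
      moreover from this have "\<phi> z = 0" by (simp add: \<phi>_def)
      ultimately show ?thesis
        by (simp add: dt_def grad_x_def lap_x_def dx_def D1 D2 vec_eq_iff)
    qed
    ultimately show ?thesis by blast
  qed
  ultimately show ?thesis by blast
qed

section \<open>Hoelder's inequality in mixed Lebesgue spaces\<close>

lemma ennreal_powr_ennreal: "x \<ge> 0 \<Longrightarrow> ennreal_powr (ennreal x) a = ennreal (x powr a)"
  by (simp add: ennreal_powr_def)

lemma ennreal_powr_top [simp]: "ennreal_powr top a = top"
  by (simp add: ennreal_powr_def)

lemma ennreal_powr_0 [simp]: "ennreal_powr 0 a = 0"
  by (simp add: ennreal_powr_def)

lemma ennreal_powr_1 [simp]: "ennreal_powr x 1 = x"
  by (cases x) (auto simp: ennreal_powr_ennreal)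

lemma ennreal_powr_powr: "ennreal_powr (ennreal_powr x a) b = ennreal_powr x (a * b)"
  by (cases x) (auto simp: ennreal_powr_ennreal powr_powr)

lemma ennreal_powr_mono: "x \<le> y \<Longrightarrow> a \<ge> 0 \<Longrightarrow> ennreal_powr x a \<le> ennreal_powr y a"
  by (cases x; cases y) (auto simp: ennreal_powr_ennreal top_unique intro!: powr_mono2 ennreal_leI)

lemma ennreal_powr_less_top: "x < top \<Longrightarrow> ennreal_powr x a < top"
  by (cases x) (auto simp: ennreal_powr_ennreal)

lemma borel_measurable_ennreal_powr [measurable (raw)]:
  assumes [measurable]: "F \<in> borel_measurable M"
  shows "(\<lambda>x. ennreal_powr (F x) a) \<in> borel_measurable M"
  unfolding ennreal_powr_def by measurable

text \<open>The graph of the concave function \<open>y\<^sup>\<theta>\<close> lies below its tangent at \<open>m\<close>.\<close>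

lemma ennreal_powr_le_tangent:
  assumes "0 < \<theta>" "\<theta> \<le> 1" "0 < m"
  shows "ennreal_powr y \<theta> \<le> ennreal (\<theta> * m powr (\<theta> - 1)) * y + ennreal ((1 - \<theta>) * m powr \<theta>)"
proof (cases y)
  case (real v)
  have "v powr \<theta> \<le> \<theta> * m powr (\<theta> - 1) * v + (1 - \<theta>) * m powr \<theta>"
  proof (cases "v = 0")
    case False
    then have "v > 0" using real by simp
    have eq: "m powr \<theta> = m * m powr (\<theta> - 1)"
      using assms by (simp add: powr_diff)
    have "v powr \<theta> * m powr (1 - \<theta>) \<le> \<theta> * v + (1 - \<theta>) * m"
      using assms \<open>v > 0\<close> by (intro Youngs_inequality_0) auto
    then have "v powr \<theta> * m powr (1 - \<theta>) * m powr (\<theta> - 1) \<le> (\<theta> * v + (1 - \<theta>) * m) * m powr (\<theta> - 1)"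
      by (rule mult_right_mono) simp
    also have "v powr \<theta> * m powr (1 - \<theta>) * m powr (\<theta> - 1) = v powr \<theta>"
      using assms by (simp add: mult.assoc powr_add[symmetric])
    also have "(\<theta> * v + (1 - \<theta>) * m) * m powr (\<theta> - 1) =
        \<theta> * m powr (\<theta> - 1) * v + (1 - \<theta>) * m powr \<theta>"
      unfolding eq by (simp add: algebra_simps)
    finally show ?thesis .
  qed (use assms in simp)
  then show ?thesis
    using real assms
    by (simp add: ennreal_powr_ennreal flip: ennreal_mult' ennreal_plus)
qed (use assms in \<open>simp add: ennreal_mult_top\<close>)

text \<open>Jensen's inequality for the concave function \<open>y\<^sup>\<theta>\<close> on a set of finite measure: integrate the
  tangent inequality.\<close>

lemma nn_integral_ennreal_powr_le:
  assumes y[measurable]: "y \<in> borel_measurable M" and X[measurable]: "X \<in> sets M"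
    and fin: "emeasure M X < top" and \<theta>: "0 < \<theta>" "\<theta> \<le> 1"
  shows "(\<integral>\<^sup>+x. ennreal_powr (y x) \<theta> * indicator X x \<partial>M) \<le>
    ennreal_powr (\<integral>\<^sup>+x. y x \<partial>M) \<theta> * ennreal (measure M X powr (1 - \<theta>))"
proof -
  define V where "V = measure M X"
  have V: "emeasure M X = ennreal V" using fin by (simp add: V_def emeasure_eq_ennreal_measure)
  consider "V = 0" | "V > 0" "(\<integral>\<^sup>+x. y x \<partial>M) = top" | "(\<integral>\<^sup>+x. y x \<partial>M) = 0"
    | A where "V > 0" "A > 0" "(\<integral>\<^sup>+x. y x \<partial>M) = ennreal A"
  proof -
    have "V = 0 \<or> V > 0" using measure_nonneg[of M X] unfolding V_def by linarith
    moreover have "(\<integral>\<^sup>+x. y x \<partial>M) = top \<or> (\<integral>\<^sup>+x. y x \<partial>M) = 0 \<or>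
        (\<exists>A>0. (\<integral>\<^sup>+x. y x \<partial>M) = ennreal A)"
    proof (cases "\<integral>\<^sup>+x. y x \<partial>M")
      case (real A)
      then show ?thesis by (cases "A = 0") (auto intro!: exI[of _ A])
    qed simp
    ultimately show ?thesis using that by blast
  qed
  then show ?thesis
  proof cases
    case 1
    then have "X \<in> null_sets M" using V by (auto simp: null_sets_def)
    then have "AE x in M. x \<notin> X" by (rule AE_not_in)
    then have "(\<integral>\<^sup>+x. ennreal_powr (y x) \<theta> * indicator X x \<partial>M) = 0"
      by (subst nn_integral_0_iff_AE) auto
    then show ?thesis by simp
  next
    case 2
    then show ?thesis by (simp add: ennreal_top_mult V_def)
  next
    case 3
    then have "AE x in M. y x = 0" by (subst (asm) nn_integral_0_iff_AE) auto
    then have "(\<integral>\<^sup>+x. ennreal_powr (y x) \<theta> * indicator X x \<partial>M) = 0"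
      by (subst nn_integral_0_iff_AE) auto
    then show ?thesis by simp
  next
    case (4 A)
    \<comment> \<open>The tangent at the mean of \<open>y\<close> gives the optimal bound.\<close>
    define m where "m = A / V"
    have m: "m > 0" using 4 by (simp add: m_def)
    let ?c = "\<theta> * m powr (\<theta> - 1)" and ?e = "(1 - \<theta>) * m powr \<theta>"
    have "(\<integral>\<^sup>+x. ennreal_powr (y x) \<theta> * indicator X x \<partial>M) \<le>
        (\<integral>\<^sup>+x. ennreal ?c * y x + ennreal ?e * indicator X x \<partial>M)"
      using ennreal_powr_le_tangent[OF \<theta> m]
      by (intro nn_integral_mono) (auto split: split_indicator)
    also have "\<dots> = ennreal ?c * ennreal A + ennreal ?e * ennreal V"
      by (simp add: nn_integral_add nn_integral_cmult nn_integral_cmult_indicator 4 V)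
    also have "\<dots> = ennreal (?c * A + ?e * V)"
      using \<theta> 4 m by (simp add: ennreal_mult')
    also have "?c * A + ?e * V = A powr \<theta> * V powr (1 - \<theta>)"
    proof -
      have "m powr (\<theta> - 1) * A = m powr \<theta> * V"
        using m 4 by (simp add: powr_diff) (simp add: m_def)
      then have "?c * A + ?e * V = m powr \<theta> * V" by (simp add: algebra_simps)
      also have "\<dots> = A powr \<theta> * V powr (1 - \<theta>)"
        using 4 by (simp add: m_def powr_divide powr_diff)
      finally show ?thesis .
    qed
    also have "ennreal (A powr \<theta> * V powr (1 - \<theta>)) =
        ennreal_powr (\<integral>\<^sup>+x. y x \<partial>M) \<theta> * ennreal (measure M X powr (1 - \<theta>))"
      using 4 by (simp add: ennreal_powr_ennreal ennreal_mult' V_def)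
    finally show ?thesis .
  qed
qed

lemma enn2real_inverse_ennreal: "x > 0 \<Longrightarrow> enn2real (1 / ennreal x) = 1 / x"
  by (metis divide_ennreal enn2real_ennreal ennreal_1 zero_le_divide_1_iff less_eq_real_def zero_le_one)

text \<open>Hoelder's inequality on a set of finite measure. Writing the exponent as
  \<open>1 - a * enn2real (1 / q)\<close> covers \<open>q = \<infinity>\<close>, where it is 1.\<close>

lemma nn_integral_le_Lp_norm:
  assumes F[measurable]: "F \<in> borel_measurable M" and X[measurable]: "X \<in> sets M"
    and fin: "emeasure M X < top" and a: "0 < a" "ennreal a \<le> q"
  shows "(\<integral>\<^sup>+x. ennreal_powr (F x) a * indicator X x \<partial>M) \<le>
    ennreal_powr (Lp_norm M q F) a * ennreal (measure M X powr (1 - a * enn2real (1 / q)))"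
proof (cases q)
  case (real q')
  have q': "q' > 0" "a \<le> q'" using a real by (auto simp: ennreal_le_iff)
  have "(\<integral>\<^sup>+x. ennreal_powr (F x) a * indicator X x \<partial>M) =
      (\<integral>\<^sup>+x. ennreal_powr (ennreal_powr (F x) q') (a / q') * indicator X x \<partial>M)"
    using q' by (simp add: ennreal_powr_powr)
  also have "\<dots> \<le> ennreal_powr (\<integral>\<^sup>+x. ennreal_powr (F x) q' \<partial>M) (a / q') *
      ennreal (measure M X powr (1 - a / q'))"
    by (rule nn_integral_ennreal_powr_le) (use fin a q' in auto)
  also have "ennreal_powr (\<integral>\<^sup>+x. ennreal_powr (F x) q' \<partial>M) (a / q') = ennreal_powr (Lp_norm M q F) a"
    using real q' by (simp add: Lp_norm_def ennreal_powr_powr)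
  also have "a / q' = a * enn2real (1 / q)"
    using q' real by (simp add: enn2real_inverse_ennreal)
  finally show ?thesis .
next
  case top
  let ?N = "Lp_norm M q F"
  have "AE x in M. F x \<le> ?N" using esssup_AE[of F M] by (simp add: Lp_norm_def top)
  then have "(\<integral>\<^sup>+x. ennreal_powr (F x) a * indicator X x \<partial>M) \<le>
      (\<integral>\<^sup>+x. ennreal_powr ?N a * indicator X x \<partial>M)"
    by (intro nn_integral_mono_AE, elim eventually_mono)
       (use a in \<open>auto intro!: mult_right_mono ennreal_powr_mono\<close>)
  also have "\<dots> = ennreal_powr ?N a * ennreal (measure M X)"
    using fin by (simp add: nn_integral_cmult_indicator emeasure_eq_ennreal_measure)
  finally show ?thesis by (simp add: top)
qed

text \<open>Hoelder's inequality is also applied in the time variable, to the spatial norm as a function of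
  time, which therefore has to be measurable. For \<open>r = \<infinity>\<close> the norm is at most \<open>c\<close> if and only if the
  superlevel set of \<open>c\<close> in the slice is null, and the measure of the slices depends measurably on
  \<open>t\<close>.\<close>

lemma borel_measurable_Lp_norm:
  fixes g :: "'a::euclidean_space \<times> 'b::euclidean_space \<Rightarrow> ennreal"
  assumes [measurable]: "g \<in> borel_measurable borel"
  shows "(\<lambda>t. Lp_norm lborel r (\<lambda>x. g (x, t))) \<in> borel_measurable borel"
proof (cases "r = \<infinity>")
  case False
  have [measurable]: "g \<in> borel_measurable (borel \<Otimes>\<^sub>M borel)"
    using assms by (simp add: borel_prod)
  have "(\<lambda>t. \<integral>\<^sup>+x. ennreal_powr (g (x, t)) (enn2real r) \<partial>lborel) \<in> borel_measurable borel"
    by (rule lborel.borel_measurable_nn_integral) measurable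
  then show ?thesis using False by (simp add: Lp_norm_def)
next
  case True
  have [measurable]: "g \<in> borel_measurable (borel \<Otimes>\<^sub>M borel)"
    using assms by (simp add: borel_prod)
  have "{t \<in> space borel. esssup lborel (\<lambda>x. g (x, t)) \<le> c} \<in> sets borel" for c
  proof -
    have "esssup lborel (\<lambda>x. g (x, t)) \<le> c \<longleftrightarrow> emeasure lborel {x. c < g (x, t)} = 0" for t
    proof -
      have "esssup lborel (\<lambda>x. g (x, t)) \<le> c \<longleftrightarrow> (AE x in lborel. g (x, t) \<le> c)"
        using esssup_AE[of "\<lambda>x. g (x, t)" lborel]
        by (auto intro!: esssup_I elim!: AE_mp)
      also have "\<dots> \<longleftrightarrow> emeasure lborel {x. c < g (x, t)} = 0"
        by (subst AE_iff_measurable[OF _ refl]) (auto simp: not_le)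
      finally show ?thesis .
    qed
    moreover have "(\<lambda>t. emeasure lborel {x. c < g (x, t)}) \<in> borel_measurable borel"
    proof -
      have "{p \<in> space (borel \<Otimes>\<^sub>M lborel). c < g (snd p, fst p)} \<in> sets (borel \<Otimes>\<^sub>M lborel)"
        by measurable
      from lborel.measurable_emeasure_Pair[OF this] show ?thesis
        by (simp add: vimage_def space_pair_measure)
    qed
    ultimately show ?thesis by simp
  qed
  then show ?thesis
    using True by (simp add: Lp_norm_def borel_measurableI_le)
qed

text \<open>This passes from norms of Lebesgue measurable functions to norms of Borel representatives, for
  which Fubini's theorem is available. The function \<open>F\<close> is arbitrary because it may be a single slice of a
  measurable function of two variables; if it is not measurable, its essential supremum is \<open>\<infinity>\<close> by
  convention.\<close>

lemma Lp_norm_lborel_le_lebesgue_on: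
  assumes K[measurable]: "K \<in> sets borel" and G[measurable]: "G \<in> borel_measurable borel"
    and le: "AE x in lborel. x \<in> K \<longrightarrow> G x \<le> F x"
  shows "Lp_norm lborel q (\<lambda>x. G x * indicator K x) \<le> Lp_norm (lebesgue_on K) q F"
proof (cases "q = \<infinity>")
  case False
  let ?q = "enn2real q"
  have "(\<integral>\<^sup>+x. ennreal_powr (G x * indicator K x) ?q \<partial>lborel) \<le>
      (\<integral>\<^sup>+x. ennreal_powr (F x) ?q * indicator K x \<partial>lborel)"
    by (rule nn_integral_mono_AE, use le in eventually_elim)
      (auto split: split_indicator intro!: ennreal_powr_mono)
  also have "\<dots> = (\<integral>\<^sup>+x. ennreal_powr (F x) ?q \<partial>lebesgue_on K)"
    by (subst nn_integral_restrict_space) (auto simp: nn_integral_completion)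
  finally show ?thesis
    using False by (simp add: Lp_norm_def ennreal_powr_mono)
next
  case True
  let ?N = "esssup (lebesgue_on K) F"
  have "AE x in lebesgue_on K. F x \<le> ?N" by (rule esssup_AE)
  then have "AE x in lebesgue. x \<in> K \<longrightarrow> F x \<le> ?N"
    by (subst (asm) AE_restrict_space_iff) auto
  then have "AE x in lborel. x \<in> K \<longrightarrow> F x \<le> ?N"
    by (simp add: AE_completion_iff)
  with le have "AE x in lborel. G x * indicator K x \<le> ?N"
    by eventually_elim (auto split: split_indicator)
  then have "esssup lborel (\<lambda>x. G x * indicator K x) \<le> ?N"
    by (rule esssup_I[rotated]) auto
  then show ?thesis using True by (simp add: Lp_norm_def)
qed

lemma AE_lborel_slices:
  fixes P :: "'a::euclidean_space \<times> 'b::euclidean_space \<Rightarrow> bool"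
  assumes "AE z in lborel. P z"
  shows "AE t in lborel. AE x in lborel. P (x, t)"
proof -
  obtain N where N: "N \<in> null_sets lborel" "{z. \<not> P z} \<subseteq> N"
    using assms by (auto simp: eventually_ae_filter)
  have N': "N \<in> sets (lborel \<Otimes>\<^sub>M lborel)" using null_setsD2[OF N(1)] unfolding lborel_prod .
  have "(\<integral>\<^sup>+t. emeasure lborel ((\<lambda>x. (x, t)) -` N) \<partial>lborel) = 0"
    using lborel_pair.emeasure_pair_measure_alt2[OF N'] N(1) by (simp add: lborel_prod null_sets_def)
  moreover have "(\<lambda>t. emeasure lborel ((\<lambda>x. (x, t)) -` N)) \<in> borel_measurable lborel"
    by (rule lborel_pair.measurable_emeasure_Pair2[OF N'])
  ultimately have "AE t in lborel. emeasure lborel ((\<lambda>x. (x, t)) -` N) = 0"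
    by (subst (asm) nn_integral_0_iff_AE) auto
  then show ?thesis
  proof eventually_elim
    case (elim t)
    have "(\<lambda>x. (x, t)) -` N \<in> sets lborel"
      using sets_Pair2[OF N', of t] by simp
    then have "(\<lambda>x. (x, t)) -` N \<in> null_sets lborel"
      using elim by (auto simp: null_sets_def)
    then show ?case by (rule AE_I') (use N(2) in auto)
  qed
qed

text \<open>The inner Hoelder inequality bounds the integral over \<open>X\<close> at a fixed time by the \<open>a\<close>-th power of
  the spatial \<open>L\<^sup>r\<close> norm, the outer one integrates that power over \<open>J\<close>. As \<open>f\<close> is only Lebesgue
  measurable, this is carried out for a Borel function that equals \<open>norm f\<close> almost everywhere.\<close>

lemma Lq_Lr_nn_integral_bound:
  fixes f :: "'a::euclidean_space \<times> real \<Rightarrow> 'b::euclidean_space"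
  assumes f: "Lq_Lr q r I K f" and I: "compact I" and K: "compact K"
    and a: "0 < a" "ennreal a \<le> q" "ennreal a \<le> r"
  shows "\<exists>M\<ge>0. \<forall>X J. X \<in> sets borel \<longrightarrow> X \<subseteq> K \<longrightarrow> J \<in> sets borel \<longrightarrow> J \<subseteq> I \<longrightarrow>
    (\<integral>\<^sup>+z. ennreal (norm (f z) powr a) * indicator (X \<times> J) z \<partial>lebesgue) \<le>
    ennreal (M * measure lborel X powr (1 - a * enn2real (1 / r))
               * measure lborel J powr (1 - a * enn2real (1 / q)))"
proof -
  have [measurable]: "K \<in> sets borel" "I \<in> sets borel" using I K by (auto simp: borel_compact)
  have KI: "K \<times> I \<in> sets borel" using I K by (intro borel_compact compact_Times)
  have "(\<lambda>z. ennreal (norm (f z))) \<in> borel_measurable (lebesgue_on (K \<times> I))"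
    using f by (auto simp: Lq_Lr_def)
  then have "(\<lambda>z. ennreal (norm (f z)) * indicator (K \<times> I) z) \<in> borel_measurable lebesgue"
    using KI by (subst (asm) borel_measurable_restrict_space_iff_ennreal) auto
  from completion_ex_borel_measurable[OF this]
  obtain g where g[measurable]: "g \<in> borel_measurable borel"
    and gf: "AE z in lborel. ennreal (norm (f z)) * indicator (K \<times> I) z = g z"
    by auto
  have [measurable]: "g \<in> borel_measurable (borel \<Otimes>\<^sub>M borel)"
    using g by (simp add: borel_prod)
  \<comment> \<open>The spatial norm of the Borel representative: measurable in \<open>t\<close>, and almost everywhere at most
    the spatial norm of \<open>f\<close>.\<close>
  define k where "k t = Lp_norm lborel r (\<lambda>x. g (x, t) * indicator K x)" for t
  have "(\<lambda>z. g z * indicator K (fst z)) \<in> borel_measurable borel"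
    by (simp add: borel_prod[symmetric])
  from borel_measurable_Lp_norm[OF this, of r]
  have k[measurable]: "k \<in> borel_measurable borel" by (simp add: k_def[abs_def])
  have k_le: "AE t in lborel. t \<in> I \<longrightarrow>
      k t \<le> Lp_norm (lebesgue_on K) r (\<lambda>x. ennreal (norm (f (x, t))))"
    using AE_lborel_slices[OF gf]
  proof eventually_elim
    case (elim t)
    show ?case
    proof
      assume "t \<in> I"
      with elim have "AE x in lborel. x \<in> K \<longrightarrow> g (x, t) \<le> ennreal (norm (f (x, t)))"
        by (auto elim!: eventually_mono split: split_indicator_asm)
      then show "k t \<le> Lp_norm (lebesgue_on K) r (\<lambda>x. ennreal (norm (f (x, t))))"
        unfolding k_def by (intro Lp_norm_lborel_le_lebesgue_on) auto
    qed
  qed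
  define N where "N = Lp_norm lborel q (\<lambda>t. k t * indicator I t)"
  have "N \<le> Lp_norm (lebesgue_on I) q (\<lambda>t. Lp_norm (lebesgue_on K) r (\<lambda>x. ennreal (norm (f (x, t)))))"
    unfolding N_def by (rule Lp_norm_lborel_le_lebesgue_on) (use k_le in auto)
  also have "\<dots> < top" using f by (auto simp: Lq_Lr_def)
  finally have N: "ennreal_powr N a = ennreal (enn2real (ennreal_powr N a))"
    using ennreal_powr_less_top[of N a] by (simp add: less_top)
  have "(\<integral>\<^sup>+z. ennreal (norm (f z) powr a) * indicator (X \<times> J) z \<partial>lebesgue) \<le>
    ennreal (enn2real (ennreal_powr N a) * measure lborel X powr (1 - a * enn2real (1 / r))
               * measure lborel J powr (1 - a * enn2real (1 / q)))"
    if X[measurable]: "X \<in> sets borel" and XK: "X \<subseteq> K"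
      and J[measurable]: "J \<in> sets borel" and JI: "J \<subseteq> I" for X J
  proof -
    have finX: "emeasure lborel X < top"
      using emeasure_mono[OF XK, of lborel] emeasure_compact_finite[OF K] by auto
    have finJ: "emeasure lborel J < top"
      using emeasure_mono[OF JI, of lborel] emeasure_compact_finite[OF I] by auto
    let ?x = "ennreal (measure lborel X powr (1 - a * enn2real (1 / r)))"
    let ?j = "ennreal (measure lborel J powr (1 - a * enn2real (1 / q)))"
    have "(\<integral>\<^sup>+z. ennreal (norm (f z) powr a) * indicator (X \<times> J) z \<partial>lebesgue) =
        (\<integral>\<^sup>+z. ennreal_powr (g z) a * indicator (X \<times> J) z \<partial>lborel)"
      unfolding nn_integral_completion
      by (rule nn_integral_cong_AE, use gf in eventually_elim)
        (use XK JI in \<open>auto split: split_indicator split_indicator_asm simp: ennreal_powr_ennreal[symmetric]\<close>)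
    also have "\<dots> = (\<integral>\<^sup>+z. ennreal_powr (g z) a * indicator (X \<times> J) z \<partial>(lborel \<Otimes>\<^sub>M lborel))"
      by (simp add: lborel_prod)
    also have "\<dots> = (\<integral>\<^sup>+t. \<integral>\<^sup>+x. ennreal_powr (g (x, t)) a * indicator (X \<times> J) (x, t) \<partial>lborel \<partial>lborel)"
      by (rule lborel_pair.nn_integral_snd[symmetric]) measurable
    also have "\<dots> \<le> (\<integral>\<^sup>+t. ?x * (ennreal_powr (k t * indicator I t) a * indicator J t) \<partial>lborel)"
    proof (rule nn_integral_mono)
      fix t :: real
      have "(\<integral>\<^sup>+x. ennreal_powr (g (x, t)) a * indicator (X \<times> J) (x, t) \<partial>lborel) =
          (\<integral>\<^sup>+x. ennreal_powr (g (x, t) * indicator K x) a * indicator X x * indicator J t \<partial>lborel)"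
        by (rule nn_integral_cong) (use XK in \<open>auto split: split_indicator\<close>)
      also have "\<dots> = (\<integral>\<^sup>+x. ennreal_powr (g (x, t) * indicator K x) a * indicator X x \<partial>lborel) * indicator J t"
        by (rule nn_integral_multc) measurable
      also have "\<dots> \<le> (ennreal_powr (k t) a * ?x) * indicator J t"
        unfolding k_def
        by (intro mult_right_mono nn_integral_le_Lp_norm) (use finX a in \<open>auto\<close>)
      also have "\<dots> = ?x * (ennreal_powr (k t * indicator I t) a * indicator J t)"
        using JI by (auto split: split_indicator simp: mult.commute)
      finally show "(\<integral>\<^sup>+x. ennreal_powr (g (x, t)) a * indicator (X \<times> J) (x, t) \<partial>lborel) \<le>
        ?x * (ennreal_powr (k t * indicator I t) a * indicator J t)" .
    qed
    also have "\<dots> = ?x * (\<integral>\<^sup>+t. ennreal_powr (k t * indicator I t) a * indicator J t \<partial>lborel)"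
      by (rule nn_integral_cmult) measurable
    also have "\<dots> \<le> ?x * (ennreal_powr N a * ?j)"
      unfolding N_def by (intro mult_left_mono nn_integral_le_Lp_norm) (use finJ a in auto)
    also have "\<dots> = ennreal (enn2real (ennreal_powr N a) * measure lborel X powr (1 - a * enn2real (1 / r))
               * measure lborel J powr (1 - a * enn2real (1 / q)))"
      by (subst N) (simp add: ennreal_mult' mult_ac)
    finally show ?thesis .
  qed
  then show ?thesis by (intro exI[of _ "enn2real (ennreal_powr N a)"]) auto
qed

section \<open>Growth of the dissipation on parabolic cylinders\<close>

lemma enn2real_divide: "enn2real (x / y) = enn2real x * enn2real (1 / y)"
  by (simp add: divide_ennreal_def enn2real_mult)

lemma enn2real_inverse_half: "enn2real (1 / (x / 2)) = 2 * enn2real (1 / x)"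
proof (cases x)
  case (real v)
  show ?thesis
  proof (cases "v = 0")
    case False
    then have "v > 0" using real by simp
    then have "x / 2 = ennreal (v / 2)" using real divide_ennreal[of v 2] by simp
    then show ?thesis
      using \<open>v > 0\<close> real enn2real_inverse_ennreal[of "v / 2"] enn2real_inverse_ennreal[of v] by simp
  qed (simp add: real)
qed (simp add: divide_ennreal_def ennreal_top_mult)

text \<open>The two balls have measures proportional to \<open>\<delta>\<^sup>d\<close> and to \<open>\<delta>\<^sup>2\<close>.\<close>

lemma Lq_Lr_parabolic_scaling:
  fixes f :: "'a::euclidean_space \<times> real \<Rightarrow> 'b::euclidean_space"
  assumes f: "Lq_Lr q r I K f" and I: "compact I" and K: "compact K"
    and a: "0 < a" "ennreal a \<le> q" "ennreal a \<le> r"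
  shows "\<exists>M\<ge>0. \<forall>x t \<delta>. 0 < \<delta> \<longrightarrow> cball x (2 * \<delta>) \<subseteq> K \<longrightarrow> cball t (2 * \<delta>\<^sup>2) \<subseteq> I \<longrightarrow>
    (\<integral>\<^sup>+z. ennreal (norm (f z) powr a) * indicator (cball x (2 * \<delta>) \<times> cball t (2 * \<delta>\<^sup>2)) z \<partial>lebesgue)
    \<le> ennreal (M * \<delta> powr (real DIM('a) + 2 - a * (real DIM('a) * enn2real (1 / r) + 2 * enn2real (1 / q))))"
proof -
  let ?d = "real DIM('a)"
  define \<alpha> where "\<alpha> = 1 - a * enn2real (1 / r)"
  define \<beta> where "\<beta> = 1 - a * enn2real (1 / q)"
  obtain M where M: "M \<ge> 0" "\<And>X J. X \<in> sets borel \<Longrightarrow> X \<subseteq> K \<Longrightarrow> J \<in> sets borel \<Longrightarrow> J \<subseteq> I \<Longrightarrow>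
    (\<integral>\<^sup>+z. ennreal (norm (f z) powr a) * indicator (X \<times> J) z \<partial>lebesgue) \<le>
    ennreal (M * measure lborel X powr \<alpha> * measure lborel J powr \<beta>)"
    using Lq_Lr_nn_integral_bound[OF assms] unfolding \<alpha>_def \<beta>_def by blast
  define c where "c = unit_ball_vol ?d * 2 ^ DIM('a)"
  have c: "c > 0" by (simp add: c_def)
  have bound: "(\<integral>\<^sup>+z. ennreal (norm (f z) powr a) * indicator (cball x (2 * \<delta>) \<times> cball t (2 * \<delta>\<^sup>2)) z \<partial>lebesgue)
    \<le> ennreal (M * c powr \<alpha> * 4 powr \<beta> *
        \<delta> powr (?d + 2 - a * (?d * enn2real (1 / r) + 2 * enn2real (1 / q))))"
    if \<delta>: "0 < \<delta>" and sub: "cball x (2 * \<delta>) \<subseteq> K" "cball t (2 * \<delta>\<^sup>2) \<subseteq> I" for x t \<delta>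
  proof -
    have X: "measure lborel (cball x (2 * \<delta>)) = c * \<delta> powr ?d"
      using \<delta> by (simp add: c_def measure_def emeasure_cball powr_realpow power_mult_distrib)
    have J: "measure lborel (cball t (2 * \<delta>\<^sup>2)) = 4 * \<delta> powr 2"
      using \<delta> by (simp add: cball_eq_atLeastAtMost)
    have "M * measure lborel (cball x (2 * \<delta>)) powr \<alpha> * measure lborel (cball t (2 * \<delta>\<^sup>2)) powr \<beta> =
        M * c powr \<alpha> * 4 powr \<beta> * (\<delta> powr (?d * \<alpha>) * \<delta> powr (2 * \<beta>))"
      unfolding X J using \<delta> c by (simp add: powr_mult powr_powr del: powr_numeral)
    also have "\<delta> powr (?d * \<alpha>) * \<delta> powr (2 * \<beta>) =
        \<delta> powr (?d + 2 - a * (?d * enn2real (1 / r) + 2 * enn2real (1 / q)))"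
      unfolding powr_add[symmetric] \<alpha>_def \<beta>_def by (simp add: algebra_simps)
    finally have eq: "M * measure lborel (cball x (2 * \<delta>)) powr \<alpha> * measure lborel (cball t (2 * \<delta>\<^sup>2)) powr \<beta> =
        M * c powr \<alpha> * 4 powr \<beta> *
        \<delta> powr (?d + 2 - a * (?d * enn2real (1 / r) + 2 * enn2real (1 / q)))" .
    show ?thesis unfolding eq[symmetric] by (rule M(2)) (use sub in auto)
  qed
  show ?thesis
    by (rule exI[of _ "M * c powr \<alpha> * 4 powr \<beta>"]) (use M(1) bound in auto)
qed

lemma Lq_Lr_powr_indicator_measurable:
  fixes f :: "'a::euclidean_space \<times> real \<Rightarrow> 'b::euclidean_space"
  assumes f: "Lq_Lr q r I K f" and E: "E \<in> sets borel" "E \<subseteq> K \<times> I"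
  shows "(\<lambda>z. ennreal (norm (f z) powr a) * indicator E z) \<in> borel_measurable lebesgue"
proof -
  have "f \<in> borel_measurable (lebesgue_on E)"
    using f E(2) by (auto simp: Lq_Lr_def intro: measurable_restrict_mono)
  then have "(\<lambda>z. ennreal (norm (f z) powr a)) \<in> borel_measurable (lebesgue_on E)"
    by measurable
  then show ?thesis
    using E(1) by (subst (asm) borel_measurable_restrict_space_iff_ennreal) auto
qed

text \<open>The integrand of the dissipation, with \<open>v\<close> for the velocity, \<open>\<pi>\<close> for the pressure, \<open>g\<close> for the norm
  of the velocity gradient, and \<open>h, a, w, b\<close> for the test function, its time derivative, gradient and
  Laplacian. The bound uses Young's inequality with exponents 3/2 and 3 on the product of pressure
  and velocity, and discards the last term, which is not positive.\<close>

lemma energy_flux_pointwise_bound: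
  fixes v w :: "'a::euclidean_space" and \<pi> \<nu> a b g e h A B :: real
  assumes "\<nu> > 0" "\<bar>a\<bar> \<le> A" "norm w \<le> B" "\<bar>b\<bar> \<le> A" "h \<ge> 0"
  shows "(norm v)\<^sup>2 / 2 * a + ((norm v)\<^sup>2 / 2 + \<pi>) * (v \<bullet> w) + \<nu> * ((norm v)\<^sup>2 / 2) * b - \<nu> * g\<^sup>2 * h
    \<le> A * (1 + \<nu>) * norm v powr 2 + 2 * B * norm v powr 3 + B * norm \<pi> powr (3 / 2)"
proof -
  let ?V = "norm v"
  have A: "A \<ge> 0" using assms(2) by linarith
  have B: "B \<ge> 0" using assms(3) norm_ge_zero[of w] by linarith
  have 1: "?V\<^sup>2 / 2 * a \<le> ?V\<^sup>2 * A"
  proof -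
    have "?V\<^sup>2 / 2 * a \<le> ?V\<^sup>2 / 2 * A" using assms(2) by (intro mult_left_mono) auto
    also have "\<dots> \<le> ?V\<^sup>2 * A" using A by (intro mult_right_mono) auto
    finally show ?thesis .
  qed
  have 2: "\<nu> * (?V\<^sup>2 / 2) * b \<le> \<nu> * ?V\<^sup>2 * A"
  proof -
    have "\<nu> * (?V\<^sup>2 / 2) * b \<le> \<nu> * (?V\<^sup>2 / 2) * A" using assms by (intro mult_left_mono) auto
    also have "\<dots> \<le> \<nu> * ?V\<^sup>2 * A" using A assms(1) by (intro mult_right_mono mult_left_mono) auto
    finally show ?thesis .
  qed
  have 3: "(?V\<^sup>2 / 2 + \<pi>) * (v \<bullet> w) \<le> B * (2 * ?V ^ 3 + \<bar>\<pi>\<bar> powr (3 / 2))"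
  proof -
    have young: "\<bar>\<pi>\<bar> * ?V \<le> \<bar>\<pi>\<bar> powr (3 / 2) + ?V ^ 3"
    proof -
      have "\<bar>\<pi>\<bar> * ?V \<le> \<bar>\<pi>\<bar> powr (3 / 2) / (3 / 2) + ?V powr 3 / 3"
        by (rule Youngs_inequality) auto
      also have "\<dots> \<le> \<bar>\<pi>\<bar> powr (3 / 2) + ?V ^ 3"
        by (intro add_mono) auto
      finally show ?thesis .
    qed
    have "(?V\<^sup>2 / 2 + \<pi>) * (v \<bullet> w) \<le> \<bar>?V\<^sup>2 / 2 + \<pi>\<bar> * \<bar>v \<bullet> w\<bar>"
      by (metis abs_ge_self abs_mult)
    also have "\<dots> \<le> (?V\<^sup>2 / 2 + \<bar>\<pi>\<bar>) * (?V * B)"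
    proof (rule mult_mono)
      show "\<bar>v \<bullet> w\<bar> \<le> ?V * B"
        using Cauchy_Schwarz_ineq2[of v w] mult_left_mono[OF assms(3) norm_ge_zero[of v]] by linarith
    qed (auto intro: order_trans[OF abs_triangle_ineq])
    also have "\<dots> = B * (?V ^ 3 / 2 + \<bar>\<pi>\<bar> * ?V)"
      by (simp add: algebra_simps power2_eq_square power3_eq_cube)
    also have "\<dots> \<le> B * (2 * ?V ^ 3 + \<bar>\<pi>\<bar> powr (3 / 2))"
    proof (intro mult_left_mono B)
      have "a / 2 + b \<le> 2 * a + c" if "b \<le> c + a" "0 \<le> a" for a b c :: real
        using that by linarith
      from this[OF young] show "?V ^ 3 / 2 + \<bar>\<pi>\<bar> * ?V \<le> 2 * ?V ^ 3 + \<bar>\<pi>\<bar> powr (3 / 2)"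
        by simp
    qed
    finally show ?thesis .
  qed
  have 4: "0 \<le> \<nu> * g\<^sup>2 * h" using assms by simp
  have "A * (1 + \<nu>) * ?V\<^sup>2 + 2 * B * ?V ^ 3 + B * \<bar>\<pi>\<bar> powr (3 / 2) =
      ?V\<^sup>2 * A + B * (2 * ?V ^ 3 + \<bar>\<pi>\<bar> powr (3 / 2)) + \<nu> * ?V\<^sup>2 * A"
    by (simp add: algebra_simps)
  with 1 2 3 4 show ?thesis by simp
qed

text \<open>Integrate \<open>indicator A \<le> \<phi>\<close>; the test function is integrable because it is bounded and
  supported in a compact set, which has finite measure.\<close>

lemma emeasure_le_distribution:
  fixes \<mu> :: "'a::euclidean_space measure"
  assumes \<mu>: "distribution_is_measure W D \<mu>" and W: "open W" and \<phi>: "\<phi> \<in> test_functions W"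
    and nonneg: "\<And>z. 0 \<le> \<phi> z" and A: "open A" "A \<subseteq> W" "\<And>z. z \<in> A \<Longrightarrow> 1 \<le> \<phi> z"
  shows "emeasure \<mu> A \<le> ennreal (D \<phi>)"
proof -
  let ?K = "closure {x. \<phi> x \<noteq> 0}"
  have sets: "sets \<mu> = sets (restrict_space borel W)"
    and fin: "\<And>K. compact K \<Longrightarrow> K \<subseteq> W \<Longrightarrow> emeasure \<mu> K < \<infinity>"
    and D: "D \<phi> = (LINT z|\<mu>. \<phi> z)"
    using \<mu> \<phi> by (auto simp: distribution_is_measure_def locally_finite_borel_on_def)
  have K: "compact ?K" "?K \<subseteq> W" and smooth: "smooth_on \<phi> UNIV"
    using \<phi> by (auto simp: test_functions_def)
  have cont: "continuous_on UNIV \<phi>"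
    using smooth unfolding smooth_on_def by (metis Ck_on.simps(1))
  have in_sets: "B \<in> sets \<mu>" if "B \<in> sets borel" "B \<subseteq> W" for B
    using that W by (simp add: sets sets_restrict_space_iff)
  have meas: "\<phi> \<in> borel_measurable \<mu>"
    unfolding measurable_cong_sets[OF sets refl]
    by (intro measurable_restrict_space1 borel_measurable_continuous_onI cont)
  have "bounded (\<phi> ` ?K)"
    by (intro compact_imp_bounded compact_continuous_image K continuous_on_subset[OF cont]) auto
  then obtain B where B: "\<And>z. z \<in> ?K \<Longrightarrow> norm (\<phi> z) \<le> B"
    by (auto simp: bounded_iff)
  have int: "integrable \<mu> \<phi>"
  proof (rule integrableI_bounded_set[where A = ?K and B = B])
    show "?K \<in> sets \<mu>" using K by (intro in_sets borel_compact)
    show "emeasure \<mu> ?K < \<infinity>" using K by (intro fin)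
    show "AE x in \<mu>. x \<in> ?K \<longrightarrow> norm (\<phi> x) \<le> B" using B by simp
    have "x \<in> ?K" if "\<phi> x \<noteq> 0" for x
      by (rule subsetD[OF closure_subset]) (use that in simp)
    then show "AE x in \<mu>. x \<notin> ?K \<longrightarrow> \<phi> x = 0" by (intro AE_I2) metis
  qed (use meas in auto)
  have "emeasure \<mu> A = (\<integral>\<^sup>+z. indicator A z \<partial>\<mu>)"
    using A by (intro nn_integral_indicator[symmetric] in_sets) auto
  also have "\<dots> \<le> (\<integral>\<^sup>+z. ennreal (\<phi> z) \<partial>\<mu>)"
    using A(3) by (intro nn_integral_mono) (auto split: split_indicator)
  also have "\<dots> = ennreal (D \<phi>)"
    unfolding D by (rule nn_integral_eq_integral) (use int nonneg in auto)
  finally show ?thesis .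
qed

lemma dissipation_le_local_norms:
  fixes u :: "(real^'n) \<times> real \<Rightarrow> real^'n" and E :: "((real^'n) \<times> real) set"
  assumes \<nu>: "\<nu> > 0" and u: "Lq_Lr q r I K u" and p: "Lq_Lr q' r' I K p"
    and E: "E \<in> sets borel" "E \<subseteq> K \<times> I" and KI: "K \<times> I \<subseteq> \<Omega> \<times> {0<..<T}" and \<Omega>: "open \<Omega>"
    and \<phi>: "\<And>z. 0 \<le> \<phi> z" "\<And>z. z \<notin> E \<Longrightarrow> \<phi> z = 0 \<and> dt \<phi> z = 0 \<and> grad_x \<phi> z = 0 \<and> lap_x \<phi> z = 0"
      "\<And>z. \<bar>dt \<phi> z\<bar> \<le> A" "\<And>z. norm (grad_x \<phi> z) \<le> B" "\<And>z. \<bar>lap_x \<phi> z\<bar> \<le> A"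
    and bound: "b2 \<ge> 0" "b3 \<ge> 0" "bp \<ge> 0"
      "(\<integral>\<^sup>+z. ennreal (norm (u z) powr 2) * indicator E z \<partial>lebesgue) \<le> ennreal b2"
      "(\<integral>\<^sup>+z. ennreal (norm (u z) powr 3) * indicator E z \<partial>lebesgue) \<le> ennreal b3"
      "(\<integral>\<^sup>+z. ennreal (norm (p z) powr (3 / 2)) * indicator E z \<partial>lebesgue) \<le> ennreal bp"
  shows "dissipation \<Omega> T \<nu> u p \<phi> \<le> A * (1 + \<nu>) * b2 + 2 * B * b3 + B * bp"
proof -
  let ?W = "\<Omega> \<times> {0<..<T}"
  have A: "A \<ge> 0" using \<phi>(3)[of undefined] by linarith
  have B: "B \<ge> 0" using \<phi>(4)[of undefined] norm_ge_zero[of "grad_x \<phi> undefined"] by linarith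
  define F where "F z = (norm (u z))\<^sup>2 / 2 * dt \<phi> z
      + ((norm (u z))\<^sup>2 / 2 + p z) * (u z \<bullet> grad_x \<phi> z)
      + \<nu> * ((norm (u z))\<^sup>2 / 2) * lap_x \<phi> z
      - \<nu> * (norm (spatial_grad \<Omega> T u z))\<^sup>2 * \<phi> z" for z
  define g2 where "g2 z = ennreal (norm (u z) powr 2) * indicator E z" for z
  define g3 where "g3 z = ennreal (norm (u z) powr 3) * indicator E z" for z
  define gp where "gp z = ennreal (norm (p z) powr (3 / 2)) * indicator E z" for z
  have [measurable]: "g2 \<in> borel_measurable lebesgue" "g3 \<in> borel_measurable lebesgue"
      "gp \<in> borel_measurable lebesgue"
    unfolding g2_def[abs_def] g3_def[abs_def] gp_def[abs_def]
    by (rule Lq_Lr_powr_indicator_measurable[OF u E] Lq_Lr_powr_indicator_measurable[OF p E])+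
  have pt: "ennreal (F z) * indicator ?W z \<le>
      ennreal (A * (1 + \<nu>)) * g2 z + ennreal (2 * B) * g3 z + ennreal B * gp z" for z
  proof (cases "z \<in> E")
    case True
    have "ennreal (F z) * indicator ?W z \<le> ennreal (F z)" by (simp split: split_indicator)
    also have "\<dots> \<le> ennreal (A * (1 + \<nu>) * norm (u z) powr 2 + 2 * B * norm (u z) powr 3
        + B * norm (p z) powr (3 / 2))"
      unfolding F_def by (intro ennreal_leI energy_flux_pointwise_bound \<nu> \<phi>)
    also have "\<dots> = ennreal (A * (1 + \<nu>)) * g2 z + ennreal (2 * B) * g3 z + ennreal B * gp z"
      using True A B \<nu> by (simp add: g2_def g3_def gp_def ennreal_mult' del: powr_numeral)
    finally show ?thesis .
  next
    case False
    then show ?thesis using \<phi>(2)[OF False] by (simp add: F_def)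
  qed
  have "?W \<in> sets borel" using \<Omega> by (intro borel_open open_Times) auto
  then have "(\<integral>\<^sup>+z. ennreal (F z) \<partial>lebesgue_on ?W) = (\<integral>\<^sup>+z. ennreal (F z) * indicator ?W z \<partial>lebesgue)"
    by (intro nn_integral_restrict_space) auto
  also have "\<dots> \<le> (\<integral>\<^sup>+z. ennreal (A * (1 + \<nu>)) * g2 z + ennreal (2 * B) * g3 z + ennreal B * gp z \<partial>lebesgue)"
    by (intro nn_integral_mono pt)
  also have "\<dots> = ennreal (A * (1 + \<nu>)) * (\<integral>\<^sup>+z. g2 z \<partial>lebesgue)
      + ennreal (2 * B) * (\<integral>\<^sup>+z. g3 z \<partial>lebesgue) + ennreal B * (\<integral>\<^sup>+z. gp z \<partial>lebesgue)"
    by (simp add: nn_integral_add nn_integral_cmult)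
  also have "\<dots> \<le> ennreal (A * (1 + \<nu>)) * ennreal b2 + ennreal (2 * B) * ennreal b3 + ennreal B * ennreal bp"
    using bound(4-6) by (intro add_mono mult_left_mono) (simp_all add: g2_def g3_def gp_def)
  also have "\<dots> = ennreal (A * (1 + \<nu>) * b2 + 2 * B * b3 + B * bp)"
    using A B \<nu> bound(1-3) by (simp add: ennreal_mult')
  \<comment> \<open>A Bochner integral is at most the integral of the positive part; this includes integrands that
    are not integrable, whose Bochner integral is 0.\<close>
  finally have "(LINT z|lebesgue_on ?W. F z) \<le> A * (1 + \<nu>) * b2 + 2 * B * b3 + B * bp"
    using A B \<nu> bound(1-3) by (intro integral_real_bounded) auto
  then show ?thesis by (simp add: dissipation_def F_def)
qed

lemma test_function_if_supported_in_compact: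
  assumes "smooth_on \<phi> UNIV" "compact E" "E \<subseteq> W" "\<And>z. z \<notin> E \<Longrightarrow> \<phi> z = 0"
  shows "\<phi> \<in> test_functions W"
proof -
  have sub: "{z. \<phi> z \<noteq> 0} \<subseteq> E" using assms(4) by blast
  then have "closure {z. \<phi> z \<noteq> 0} \<subseteq> E"
    by (rule closure_minimal) (rule compact_imp_closed[OF assms(2)])
  moreover have "compact (closure {z. \<phi> z \<noteq> 0})"
    unfolding compact_closure using compact_imp_bounded[OF assms(2)] sub by (rule bounded_subset)
  ultimately show ?thesis using assms(1,3) by (simp add: test_functions_def)
qed

text \<open>Compare the measure of the cylinder with the dissipation of the cutoff function and count powers
  of \<open>\<delta>\<close>. The constant must be the same for all cylinders near the given point, so it comes from the
  norms of \<open>u\<close> and \<open>p\<close> over one fixed compact box \<open>K \<times> I\<close> which contains all doubled cylinders.\<close>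

lemma dissipation_parabolic_growth:
  fixes u :: "(real^'n) \<times> real \<Rightarrow> real^'n" and p :: "(real^'n) \<times> real \<Rightarrow> real"
    and q r :: ennreal and \<sigma> :: real
  defines "\<sigma> \<equiv> enn2real (of_nat CARD('n) / r) + enn2real (2 / q)"
  assumes \<nu>: "\<nu> > 0" and \<Omega>: "open \<Omega>"
    and \<mu>: "distribution_is_measure (\<Omega> \<times> {0<..<T}) (dissipation \<Omega> T \<nu> u p) \<mu>"
    and qr: "q \<ge> 3" "r \<ge> 3"
    and u: "Lq_Lr_loc q r {0<..<T} \<Omega> u"
    and p: "Lq_Lr_loc (q / 2) (r / 2) {0<..<T} \<Omega> p"
    and \<sigma>: "\<sigma> \<ge> 1" and z0: "(x0, t0) \<in> \<Omega> \<times> {0<..<T}"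
  shows "\<exists>R>0. \<exists>C\<ge>0. \<forall>x t \<delta>. 0 < \<delta> \<longrightarrow> \<delta> \<le> R \<longrightarrow>
    parabolic_cylinder \<delta> x t \<inter> (ball x0 R \<times> ball t0 R) \<noteq> {} \<longrightarrow>
    parabolic_cylinder \<delta> x t \<subseteq> \<Omega> \<times> {0<..<T} \<and>
    emeasure \<mu> (parabolic_cylinder \<delta> x t) \<le> ennreal (C * \<delta> powr (real CARD('n) + 1 - 3 * \<sigma>))"
proof -
  let ?d = "real CARD('n)" and ?W = "\<Omega> \<times> {0<..<T}"
  have \<sigma>_eq: "\<sigma> = ?d * enn2real (1 / r) + 2 * enn2real (1 / q)"
    unfolding \<sigma>_def by (subst (1 2) enn2real_divide) simp
  obtain e1 where e1: "e1 > 0" "cball x0 e1 \<subseteq> \<Omega>"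
    using \<Omega> z0 by (auto simp: open_contains_cball)
  obtain e2 where e2: "e2 > 0" "cball t0 e2 \<subseteq> {0<..<T}"
    using z0 open_greaterThanLessThan[of 0 T] unfolding open_contains_cball by blast
  \<comment> \<open>If a cylinder of radius at most \<open>R\<close> meets the box of size \<open>R\<close>, its centre is at distance less
    than \<open>2R\<close> and the doubled cylinder stays within \<open>4R\<close>; \<open>R \<le> 1\<close> ensures \<open>\<delta>\<^sup>2 \<le> \<delta>\<close>.\<close>
  define R where "R = min 1 (min e1 e2 / 4)"
  have R: "R > 0" "R \<le> 1" "4 * R \<le> e1" "4 * R \<le> e2" using e1 e2 by (auto simp: R_def)
  define K where "K = cball x0 (4 * R)"
  define I where "I = cball t0 (4 * R)"
  have K: "compact K" "K \<subseteq> \<Omega>" using R e1 by (auto simp: K_def)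
  have I: "compact I" "I \<subseteq> {0<..<T}" using R e2 by (auto simp: I_def)
  have uKI: "Lq_Lr q r I K u" and pKI: "Lq_Lr (q / 2) (r / 2) I K p"
    using u p K I by (auto simp: Lq_Lr_loc_def)
  have le: "ennreal 2 \<le> x" "ennreal 3 \<le> x" "ennreal (3 / 2) \<le> x / 2" if "3 \<le> x" for x
  proof -
    show "ennreal 3 \<le> x" using that by simp
    show "ennreal 2 \<le> x" by (rule order_trans[OF _ that]) simp
    have "ennreal (3 / 2) = 3 / 2" using divide_ennreal[of 3 2] by simp
    then show "ennreal (3 / 2) \<le> x / 2" using divide_right_mono_ennreal[OF that, of 2] by simp
  qed
  define \<beta>2 where "\<beta>2 = ?d + 2 - 2 * \<sigma>"
  define \<beta>3 where "\<beta>3 = ?d + 2 - 3 * \<sigma>"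
  define s where "s = ?d + 1 - 3 * \<sigma>"
  let ?E = "\<lambda>x t \<delta>. cball x (2 * \<delta>) \<times> cball t (2 * \<delta>\<^sup>2) :: ((real^'n) \<times> real) set"
  have \<beta>2: "real DIM(real^'n) + 2 - 2 * (real DIM(real^'n) * enn2real (1 / r) + 2 * enn2real (1 / q)) = \<beta>2"
    and \<beta>3: "real DIM(real^'n) + 2 - 3 * (real DIM(real^'n) * enn2real (1 / r) + 2 * enn2real (1 / q)) = \<beta>3"
    unfolding \<beta>2_def \<beta>3_def \<sigma>_eq by simp_all
  have \<beta>p: "real DIM(real^'n) + 2 - 3 / 2 * (real DIM(real^'n) * enn2real (1 / (r / 2)) + 2 * enn2real (1 / (q / 2))) = \<beta>3"
    unfolding \<beta>3_def \<sigma>_eq enn2real_inverse_half by (simp add: field_simps)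
  obtain M2 where M2: "M2 \<ge> 0" "\<And>x t \<delta>. 0 < \<delta> \<Longrightarrow> cball x (2 * \<delta>) \<subseteq> K \<Longrightarrow> cball t (2 * \<delta>\<^sup>2) \<subseteq> I \<Longrightarrow>
    (\<integral>\<^sup>+z. ennreal (norm (u z) powr 2) * indicator (?E x t \<delta>) z \<partial>lebesgue) \<le> ennreal (M2 * \<delta> powr \<beta>2)"
    using Lq_Lr_parabolic_scaling[OF uKI I(1) K(1) zero_less_numeral le(1)[OF qr(1)] le(1)[OF qr(2)]]
    unfolding \<beta>2 by blast
  obtain M3 where M3: "M3 \<ge> 0" "\<And>x t \<delta>. 0 < \<delta> \<Longrightarrow> cball x (2 * \<delta>) \<subseteq> K \<Longrightarrow> cball t (2 * \<delta>\<^sup>2) \<subseteq> I \<Longrightarrow>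
    (\<integral>\<^sup>+z. ennreal (norm (u z) powr 3) * indicator (?E x t \<delta>) z \<partial>lebesgue) \<le> ennreal (M3 * \<delta> powr \<beta>3)"
    using Lq_Lr_parabolic_scaling[OF uKI I(1) K(1) zero_less_numeral le(2)[OF qr(1)] le(2)[OF qr(2)]]
    unfolding \<beta>3 by blast
  have pos: "0 < 3 / (2 :: real)" by simp
  obtain Mp where Mp: "Mp \<ge> 0" "\<And>x t \<delta>. 0 < \<delta> \<Longrightarrow> cball x (2 * \<delta>) \<subseteq> K \<Longrightarrow> cball t (2 * \<delta>\<^sup>2) \<subseteq> I \<Longrightarrow>
    (\<integral>\<^sup>+z. ennreal (norm (p z) powr (3 / 2)) * indicator (?E x t \<delta>) z \<partial>lebesgue) \<le> ennreal (Mp * \<delta> powr \<beta>3)"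
    using Lq_Lr_parabolic_scaling[OF pKI I(1) K(1) _ le(3)[OF qr(1)] le(3)[OF qr(2)], OF pos]
    unfolding \<beta>p by blast
  obtain C where C: "C > 0" "\<And>x t \<delta>. \<delta> > 0 \<Longrightarrow> (\<exists>\<phi> :: (real^'n) \<times> real \<Rightarrow> real.
     smooth_on \<phi> UNIV \<and> (\<forall>z. 0 \<le> \<phi> z) \<and> (\<forall>z\<in>parabolic_cylinder \<delta> x t. 1 \<le> \<phi> z) \<and>
     (\<forall>z. z \<notin> ?E x t \<delta> \<longrightarrow> \<phi> z = 0 \<and> dt \<phi> z = 0 \<and> grad_x \<phi> z = 0 \<and> lap_x \<phi> z = 0) \<and>
     (\<forall>z. \<bar>dt \<phi> z\<bar> \<le> C / \<delta>\<^sup>2 \<and> norm (grad_x \<phi> z) \<le> C / \<delta> \<and> \<bar>lap_x \<phi> z\<bar> \<le> C / \<delta>\<^sup>2))"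
    using parabolic_cutoff by blast
  define C' where "C' = C * (1 + \<nu>) * M2 + 2 * C * M3 + C * Mp"
  have C': "C' \<ge> 0" using C(1) \<nu> M2(1) M3(1) Mp(1) by (simp add: C'_def)
  have main: "parabolic_cylinder \<delta> x t \<subseteq> ?W \<and>
      emeasure \<mu> (parabolic_cylinder \<delta> x t) \<le> ennreal (C' * \<delta> powr s)"
    if \<delta>: "0 < \<delta>" "\<delta> \<le> R" and meet: "parabolic_cylinder \<delta> x t \<inter> (ball x0 R \<times> ball t0 R) \<noteq> {}"
    for x t \<delta>
  proof -
    have \<delta>1: "\<delta> \<le> 1" using \<delta> R by linarith
    have \<delta>sq: "\<delta>\<^sup>2 \<le> \<delta>" using \<delta> \<delta>1 by (simp add: power2_eq_square mult_left_le)
    obtain y \<tau> where y: "dist x y < \<delta>" "dist x0 y < R" and \<tau>: "dist t \<tau> < \<delta>\<^sup>2" "dist t0 \<tau> < R"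
    proof -
      obtain z where "z \<in> parabolic_cylinder \<delta> x t" "z \<in> ball x0 R \<times> ball t0 R"
        using meet by blast
      then show ?thesis
        by (intro that[of "fst z" "snd z"])
          (auto simp: parabolic_cylinder_def dist_real_def abs_less_iff)
    qed
    have X: "cball x (2 * \<delta>) \<subseteq> K"
    proof
      fix w assume "w \<in> cball x (2 * \<delta>)"
      then show "w \<in> K"
        using y \<delta> dist_triangle[of x0 w x] dist_triangle[of x0 x y] by (simp add: K_def dist_commute)
    qed
    have J: "cball t (2 * \<delta>\<^sup>2) \<subseteq> I"
    proof
      fix w assume "w \<in> cball t (2 * \<delta>\<^sup>2)"
      then show "w \<in> I"
        using \<tau> \<delta> \<delta>sq dist_triangle[of t0 w t] dist_triangle[of t0 t \<tau>] by (simp add: I_def dist_commute)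
    qed
    have EW: "?E x t \<delta> \<subseteq> K \<times> I" "K \<times> I \<subseteq> ?W" using X J K I by auto
    obtain \<phi> where \<phi>: "smooth_on \<phi> UNIV" "\<And>z. 0 \<le> \<phi> z" "\<And>z. z \<in> parabolic_cylinder \<delta> x t \<Longrightarrow> 1 \<le> \<phi> z"
      "\<And>z. z \<notin> ?E x t \<delta> \<Longrightarrow> \<phi> z = 0 \<and> dt \<phi> z = 0 \<and> grad_x \<phi> z = 0 \<and> lap_x \<phi> z = 0"
      "\<And>z. \<bar>dt \<phi> z\<bar> \<le> C / \<delta>\<^sup>2" "\<And>z. norm (grad_x \<phi> z) \<le> C / \<delta>" "\<And>z. \<bar>lap_x \<phi> z\<bar> \<le> C / \<delta>\<^sup>2"
      using C(2)[OF \<delta>(1), of x t] by blast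
    have cylE: "parabolic_cylinder \<delta> x t \<subseteq> ?E x t \<delta>"
      using \<delta> by (auto simp: parabolic_cylinder_def dist_real_def)
    have cylW: "parabolic_cylinder \<delta> x t \<subseteq> ?W" using cylE EW by blast
    have Ec: "compact (?E x t \<delta>)" by (intro compact_Times) auto
    have test: "\<phi> \<in> test_functions ?W"
      using \<phi>(1,4) EW Ec by (intro test_function_if_supported_in_compact[of _ "?E x t \<delta>"]) auto
    have "emeasure \<mu> (parabolic_cylinder \<delta> x t) \<le> ennreal (dissipation \<Omega> T \<nu> u p \<phi>)"
    proof (rule emeasure_le_distribution[OF \<mu> _ test \<phi>(2) _ cylW \<phi>(3)])
      show "open ?W" using \<Omega> by (intro open_Times) auto
      show "open (parabolic_cylinder \<delta> x t)" unfolding parabolic_cylinder_def by (intro open_Times) auto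
    qed
    also have "dissipation \<Omega> T \<nu> u p \<phi> \<le> C / \<delta>\<^sup>2 * (1 + \<nu>) * (M2 * \<delta> powr \<beta>2)
        + 2 * (C / \<delta>) * (M3 * \<delta> powr \<beta>3) + C / \<delta> * (Mp * \<delta> powr \<beta>3)"
      using M2(1) M3(1) Mp(1) \<delta>(1) X J EW Ec
      by (intro dissipation_le_local_norms[OF \<nu> uKI pKI _ EW \<Omega> \<phi>(2,4-7)] M2(2) M3(2) Mp(2))
        (auto intro: borel_compact)
    also have "\<dots> = C * (1 + \<nu>) * M2 * (\<delta> powr \<beta>2 / \<delta>\<^sup>2)
        + 2 * C * M3 * (\<delta> powr \<beta>3 / \<delta>) + C * Mp * (\<delta> powr \<beta>3 / \<delta>)"
      by simp
    also have "\<delta> powr \<beta>3 / \<delta> = \<delta> powr s"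
    proof -
      have "\<delta> powr \<beta>3 / \<delta> = \<delta> powr (\<beta>3 - 1)" using \<delta>(1) by (simp add: powr_diff)
      also have "\<beta>3 - 1 = s" by (simp add: \<beta>3_def s_def)
      finally show ?thesis .
    qed
    also have "C * (1 + \<nu>) * M2 * (\<delta> powr \<beta>2 / \<delta>\<^sup>2) \<le> C * (1 + \<nu>) * M2 * \<delta> powr s"
    proof (rule mult_left_mono)
      have "\<delta> powr \<beta>2 / \<delta>\<^sup>2 = \<delta> powr (\<beta>2 - 2)" using \<delta>(1) by (simp add: powr_diff)
      also have "\<dots> \<le> \<delta> powr s"
        using \<delta>(1) \<delta>1 \<sigma> by (intro powr_mono') (auto simp: \<beta>2_def s_def)
      finally show "\<delta> powr \<beta>2 / \<delta>\<^sup>2 \<le> \<delta> powr s" .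
    qed (use C(1) \<nu> M2(1) in auto)
    also have "C * (1 + \<nu>) * M2 * \<delta> powr s + 2 * C * M3 * \<delta> powr s + C * Mp * \<delta> powr s = C' * \<delta> powr s"
      by (simp add: C'_def algebra_simps)
    finally show ?thesis using cylW by (simp add: ennreal_leI)
  qed
  show ?thesis
  proof (rule exI[of _ R], rule conjI[OF R(1)], rule exI[of _ C'], rule conjI[OF C'], intro allI impI conjI)
    fix x t \<delta>
    assume "0 < \<delta>" "\<delta> \<le> R" "parabolic_cylinder \<delta> x t \<inter> (ball x0 R \<times> ball t0 R) \<noteq> {}"
    from main[OF this] show "parabolic_cylinder \<delta> x t \<subseteq> ?W"
      "emeasure \<mu> (parabolic_cylinder \<delta> x t) \<le> ennreal (C' * \<delta> powr (?d + 1 - 3 * \<sigma>))"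
      unfolding s_def by simp_all
  qed
qed

section \<open>Null sets of the parabolic Hausdorff measure\<close>

text \<open>Covers are restricted by the diameters of their cylinders, the growth bound by radii. The next
  two bounds show that either of the two is small if the other one is.\<close>

lemma diameter_parabolic_cylinder_ge:
  fixes x :: "'a::euclidean_space"
  assumes "r > 0"
  shows "r / 2 \<le> diameter (parabolic_cylinder r x t)"
proof -
  obtain b :: 'a where b: "b \<in> Basis" using nonempty_Basis by blast
  let ?y = "x + (r / 2) *\<^sub>R b"
  have "bounded (parabolic_cylinder r x t)"
    unfolding parabolic_cylinder_def
    using bounded_Times[OF bounded_ball bounded_box[of "t - r\<^sup>2" "t + r\<^sup>2"]] by (simp add: box_real)
  moreover have "(x, t) \<in> parabolic_cylinder r x t" "(?y, t) \<in> parabolic_cylinder r x t"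
    using assms b by (auto simp: parabolic_cylinder_def dist_norm)
  ultimately have "dist (x, t) (?y, t) \<le> diameter (parabolic_cylinder r x t)"
    by (rule diameter_bounded_bound)
  then show ?thesis using assms b by (simp add: dist_Pair_Pair dist_norm)
qed

lemma diameter_parabolic_cylinder_le:
  fixes x :: "'a::euclidean_space"
  assumes "0 < r" "r \<le> 1"
  shows "diameter (parabolic_cylinder r x t) \<le> 4 * r"
proof -
  show ?thesis
  proof (rule diameter_le)
    show "parabolic_cylinder r x t \<noteq> {} \<or> 0 \<le> 4 * r" using assms by simp
    fix z w assume z: "z \<in> parabolic_cylinder r x t" and w: "w \<in> parabolic_cylinder r x t"
    have r2: "r\<^sup>2 \<le> r" using assms by (simp add: power2_eq_square mult_left_le)
    have "dist (fst z) (fst w) \<le> 2 * r"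
      using z w dist_triangle[of "fst z" "fst w" x] by (auto simp: parabolic_cylinder_def dist_commute)
    moreover have "dist (snd z) (snd w) \<le> 2 * r"
      using z w r2 by (auto simp: parabolic_cylinder_def dist_real_def)
    moreover have "norm (z - w) \<le> dist (fst z) (fst w) + dist (snd z) (snd w)"
      using sqrt_sum_squares_le_sum_abs[of "norm (fst z - fst w)" "snd z - snd w"]
      by (simp add: dist_norm norm_prod_def)
    ultimately show "norm (z - w) \<le> 4 * r" by simp
  qed
qed

lemma parabolic_premeasure_antimono:
  "\<rho> \<le> \<rho>' \<Longrightarrow> parabolic_premeasure s \<rho>' A \<le> parabolic_premeasure s \<rho> A"
  unfolding parabolic_premeasure_def by (rule Inf_superset_mono) (blast intro: order_trans)

text \<open>The premeasures increase as \<open>\<rho>\<close> decreases to 0, so the limit exists and is their supremum.\<close>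

lemma parabolic_measure_eq_0_iff:
  fixes A :: "('a::euclidean_space \<times> real) set"
  shows "parabolic_measure s A = 0 \<longleftrightarrow> (\<forall>\<rho>>0. parabolic_premeasure s \<rho> A = 0)"
proof -
  let ?f = "\<lambda>\<rho>. parabolic_premeasure s \<rho> A"
  define L where "L = (SUP \<rho>\<in>{0<..}. ?f \<rho>)"
  have "(?f \<longlongrightarrow> L) (at_right 0)"
  proof (rule order_tendstoI)
    fix a assume "a < L"
    then obtain \<rho> where \<rho>: "\<rho> > 0" "a < ?f \<rho>" by (auto simp: L_def less_SUP_iff)
    have "\<forall>\<^sub>F \<rho>' in at_right 0. \<rho>' < \<rho>" using \<rho>(1) by (rule order_tendstoD[OF tendsto_ident_at])
    then show "\<forall>\<^sub>F \<rho>' in at_right 0. a < ?f \<rho>'"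
    proof eventually_elim
      case (elim \<rho>')
      then show ?case
        using less_le_trans[OF \<rho>(2) parabolic_premeasure_antimono[of \<rho>' \<rho> s A]] by simp
    qed
  next
    fix a assume "L < a"
    have "?f \<rho>' < a" if "\<rho>' > 0" for \<rho>'
      using SUP_upper[of \<rho>' "{0<..}" ?f] that \<open>L < a\<close> unfolding L_def by simp
    then show "\<forall>\<^sub>F \<rho>' in at_right 0. ?f \<rho>' < a"
      by (simp add: eventually_at_filter)
  qed
  then have "parabolic_measure s A = L"
    unfolding parabolic_measure_def by (intro tendsto_Lim) auto
  moreover have "L = 0 \<longleftrightarrow> (\<forall>\<rho>>0. ?f \<rho> = 0)"
    unfolding L_def by (subst SUP_eq_iff) auto
  ultimately show ?thesis by simp
qed

lemma parabolic_measure_eq_0D: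
  fixes A :: "('a::euclidean_space \<times> real) set"
  assumes "parabolic_measure s A = 0" "\<epsilon> > 0" "\<rho> > 0"
  obtains I :: "nat set" and r x t where "\<And>i. i \<in> I \<Longrightarrow> 0 < r i" "\<And>i. i \<in> I \<Longrightarrow> r i \<le> \<rho>"
    "A \<subseteq> (\<Union>i\<in>I. parabolic_cylinder (r i) (x i) (t i))"
    "(\<Sum>\<^sub>\<infinity>i\<in>I. ennreal (r i powr s)) < \<epsilon>"
proof -
  have "parabolic_premeasure s (\<rho> / 2) A < \<epsilon>"
    using assms parabolic_measure_eq_0_iff[of s A] by simp
  then obtain I :: "nat set" and r x t where *:
    "\<forall>i\<in>I. r i > 0 \<and> diameter (parabolic_cylinder (r i) (x i) (t i)) \<le> \<rho> / 2"
    "A \<subseteq> (\<Union>i\<in>I. parabolic_cylinder (r i) (x i) (t i))"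
    "(\<Sum>\<^sub>\<infinity>i\<in>I. ennreal (r i powr s)) < \<epsilon>"
    unfolding parabolic_premeasure_def Inf_less_iff
    by (elim bexE CollectE exE conjE) (rule that; simp)
  have "r i \<le> \<rho>" if "i \<in> I" for i
  proof -
    have "r i > 0" "diameter (parabolic_cylinder (r i) (x i) (t i)) \<le> \<rho> / 2"
      using *(1) that by auto
    then show ?thesis using diameter_parabolic_cylinder_ge[of "r i" "x i" "t i"] by linarith
  qed
  note le = this
  have "0 < r i" if "i \<in> I" for i using *(1) that by blast
  then show thesis using le *(2,3) by (rule that[of I r x t])
qed

text \<open>For radii at most 1, raising the exponent decreases the sums.\<close>

lemma parabolic_measure_eq_0_mono:
  fixes A B :: "('a::euclidean_space \<times> real) set"
  assumes A: "parabolic_measure s A = 0" and "s \<le> s'" "B \<subseteq> A"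
  shows "parabolic_measure s' B = 0"
  unfolding parabolic_measure_eq_0_iff
proof (intro allI impI)
  fix \<rho> :: real assume "\<rho> > 0"
  show "parabolic_premeasure s' \<rho> B = 0"
  proof (rule antisym)
    show "parabolic_premeasure s' \<rho> B \<le> 0"
    proof (rule dense_ge)
      fix \<epsilon> :: ennreal assume "0 < \<epsilon>"
      have "min 1 (\<rho> / 4) > 0" using \<open>\<rho> > 0\<close> by simp
      from parabolic_measure_eq_0D[OF A \<open>0 < \<epsilon>\<close> this]
      obtain I :: "nat set" and r x t where *: "\<And>i. i \<in> I \<Longrightarrow> 0 < r i" "\<And>i. i \<in> I \<Longrightarrow> r i \<le> min 1 (\<rho> / 4)"
        "A \<subseteq> (\<Union>i\<in>I. parabolic_cylinder (r i) (x i) (t i))"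
        "(\<Sum>\<^sub>\<infinity>i\<in>I. ennreal (r i powr s)) < \<epsilon>" by blast
      have "diameter (parabolic_cylinder (r i) (x i) (t i)) \<le> \<rho>" if "i \<in> I" for i
        using diameter_parabolic_cylinder_le[of "r i" "x i" "t i"] *(1,2)[OF that] by simp
      then have "parabolic_premeasure s' \<rho> B \<le> (\<Sum>\<^sub>\<infinity>i\<in>I. ennreal (r i powr s'))"
        unfolding parabolic_premeasure_def using *(1) order_trans[OF \<open>B \<subseteq> A\<close> *(3)]
        by (intro Inf_lower CollectI exI[of _ I] exI[of _ r] exI[of _ x] exI[of _ t]) simp
      also have "\<dots> \<le> (\<Sum>\<^sub>\<infinity>i\<in>I. ennreal (r i powr s))"
      proof (intro infsum_mono nonneg_summable_on_complete ennreal_leI)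
        fix i assume "i \<in> I"
        then have "0 \<le> r i" "r i \<le> 1" using *(1)[of i] *(2)[of i] by simp_all
        then show "r i powr s' \<le> r i powr s" using \<open>s \<le> s'\<close> by (intro powr_mono')
      qed simp_all
      also have "\<dots> \<le> \<epsilon>" using *(4) by simp
      finally show "parabolic_premeasure s' \<rho> B \<le> \<epsilon>" .
    qed
  qed simp
qed

lemma ennreal_infsum_nat_eq_suminf:
  fixes f :: "nat \<Rightarrow> ennreal"
  shows "(\<Sum>\<^sub>\<infinity>i\<in>I. f i) = (\<Sum>i. if i \<in> I then f i else 0)"
proof -
  have "(\<Sum>\<^sub>\<infinity>i\<in>I. f i) = (\<Sum>\<^sub>\<infinity>i. if i \<in> I then f i else 0)"
    by (rule infsum_cong_neutral) auto
  also have "\<dots> = (\<Sum>i. if i \<in> I then f i else 0)"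
    by (intro sums_unique has_sum_imp_sums has_sum_infsum nonneg_summable_on_complete) simp
  finally show ?thesis .
qed

text \<open>The easy half of Frostman's lemma (the mass distribution principle), in a local form: the growth
  is known only for cylinders that meet \<open>N\<close>, and the others can be removed from a cover of \<open>A\<close>.\<close>

lemma emeasure_eq_0_if_parabolic_measure_eq_0:
  fixes \<mu> :: "('a::euclidean_space \<times> real) measure"
  assumes A: "A \<in> sets \<mu>" "A \<subseteq> N" and null: "parabolic_measure s A = 0"
    and R: "R > 0" and C: "C \<ge> 0"
    and growth: "\<And>x t \<delta>. 0 < \<delta> \<Longrightarrow> \<delta> \<le> R \<Longrightarrow> parabolic_cylinder \<delta> x t \<inter> N \<noteq> {} \<Longrightarrow>
      parabolic_cylinder \<delta> x t \<in> sets \<mu> \<and>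
      emeasure \<mu> (parabolic_cylinder \<delta> x t) \<le> ennreal (C * \<delta> powr s)"
  shows "emeasure \<mu> A = 0"
proof -
  have "emeasure \<mu> A \<le> ennreal C * \<epsilon>" if "\<epsilon> > 0" for \<epsilon>
  proof -
    obtain I :: "nat set" and r x t where *: "\<And>i. i \<in> I \<Longrightarrow> 0 < r i" "\<And>i. i \<in> I \<Longrightarrow> r i \<le> R"
        "A \<subseteq> (\<Union>i\<in>I. parabolic_cylinder (r i) (x i) (t i))"
        "(\<Sum>\<^sub>\<infinity>i\<in>I. ennreal (r i powr s)) < \<epsilon>"
      using parabolic_measure_eq_0D[OF null \<open>\<epsilon> > 0\<close> R] by blast
    define c where "c i = parabolic_cylinder (r i) (x i) (t i)" for i
    define B where "B i = (if i \<in> I \<and> c i \<inter> N \<noteq> {} then c i else {})" for i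
    have B: "B i \<in> sets \<mu> \<and> emeasure \<mu> (B i) \<le> ennreal C * (if i \<in> I then ennreal (r i powr s) else 0)" for i
      using growth[of "r i" "x i" "t i"] *(1,2)[of i] C by (auto simp: B_def c_def ennreal_mult')
    have "A \<subseteq> (\<Union>i. B i)" using *(3) \<open>A \<subseteq> N\<close> by (force simp: B_def c_def)
    then have "emeasure \<mu> A \<le> emeasure \<mu> (\<Union>i. B i)"
      using B by (intro emeasure_mono) auto
    also have "\<dots> \<le> (\<Sum>i. emeasure \<mu> (B i))"
      using B by (intro emeasure_subadditive_countably) auto
    also have "\<dots> \<le> (\<Sum>i. ennreal C * (if i \<in> I then ennreal (r i powr s) else 0))"
      using B by (intro suminf_le) auto
    also have "\<dots> = ennreal C * (\<Sum>\<^sub>\<infinity>i\<in>I. ennreal (r i powr s))"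
      by (simp add: ennreal_infsum_nat_eq_suminf)
    also have "\<dots> \<le> ennreal C * \<epsilon>" using *(4) by (intro mult_left_mono) auto
    finally show ?thesis .
  qed
  note le = this
  have "emeasure \<mu> A \<le> 0 + ennreal e" if "e > 0" for e
  proof -
    have "emeasure \<mu> A \<le> ennreal C * ennreal (e / (C + 1))"
      using that C by (intro le) simp
    also have "\<dots> = ennreal (C * (e / (C + 1)))"
      by (rule ennreal_mult[symmetric]) (use that C in simp_all)
    also have "C * (e / (C + 1)) \<le> e"
      using that C by (simp add: field_simps)
    finally show ?thesis by (simp add: ennreal_leI)
  qed
  then have "emeasure \<mu> A \<le> 0" by (rule ennreal_le_epsilon)
  then show ?thesis by simp
qed

text \<open>By the Lindeloef property, countably many of the open sets cover \<open>A\<close>.\<close>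

lemma emeasure_eq_0_if_locally_null:
  fixes \<mu> :: "'a::second_countable_topology measure"
  assumes A: "A \<in> sets \<mu>" and borel: "\<And>U. open U \<Longrightarrow> A \<inter> U \<in> sets \<mu>"
    and loc: "\<And>z. z \<in> A \<Longrightarrow> \<exists>U. open U \<and> z \<in> U \<and> emeasure \<mu> (A \<inter> U) = 0"
  shows "emeasure \<mu> A = 0"
proof -
  define F where "F = {U. open U \<and> emeasure \<mu> (A \<inter> U) = 0}"
  obtain F' where F': "F' \<subseteq> F" "countable F'" "\<Union>F' = \<Union>F"
    using Lindelof[of F] by (auto simp: F_def)
  have "(\<Union>U\<in>F'. A \<inter> U) \<in> null_sets \<mu>"
    using F' borel by (intro null_sets_UN') (auto simp: F_def null_sets_def)
  moreover have "(\<Union>U\<in>F'. A \<inter> U) = A"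
  proof -
    have "A \<subseteq> \<Union>F'" unfolding F'(3) using loc by (auto simp: F_def)
    then show ?thesis by blast
  qed
  ultimately show ?thesis by auto
qed

section \<open>Absolute continuity and dimension of the dissipation\<close>

theorem theorem1p10:
  fixes \<nu> T s :: real
    and q r :: ennreal
    and \<Omega> :: "(real^'n) set"
    and u :: "(real^'n) \<times> real \<Rightarrow> real^'n"
    and p :: "(real^'n) \<times> real \<Rightarrow> real"
    and \<mu> :: "((real^'n) \<times> real) measure"
  assumes "\<nu> > 0" and "T > 0" and "CARD('n) \<ge> 2"
    and "smooth_domain \<Omega>"
    and "leray_hopf \<Omega> T \<nu> u"
    and "associated_pressure \<Omega> T \<nu> u p"
    and "distribution_is_measure (\<Omega> \<times> {0<..<T}) (dissipation \<Omega> T \<nu> u p) \<mu>"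
    and "q \<ge> 3" and "r \<ge> 3"
    and "Lq_Lr_loc q r {0<..<T} \<Omega> u"
    and "Lq_Lr_loc (q / 2) (r / 2) {0<..<T} \<Omega> p"
    and "enn2real (2 / q) + enn2real (of_nat CARD('n) / r) \<ge> 1"
    and "s = real CARD('n) + 1 - 3 * (enn2real (of_nat CARD('n) / r) + enn2real (2 / q))"
    and "s \<ge> 0"
  shows "(\<forall>A\<in>sets borel. A \<subseteq> \<Omega> \<times> {0<..<T} \<longrightarrow> parabolic_measure s A = 0 \<longrightarrow> emeasure \<mu> A = 0) \<and>
    (\<forall>S\<in>sets borel. emeasure \<mu> (\<Omega> \<times> {0<..<T}) \<noteq> 0 \<longrightarrow> concentrated_on \<mu> S \<longrightarrow>
      parabolic_dim S \<ge> ereal s)"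
proof -
  let ?W = "\<Omega> \<times> {0<..<T}"
  have \<Omega>: "open \<Omega>" using assms(4) by (simp add: smooth_domain_def)
  then have W: "open ?W" by (intro open_Times) auto
  have sets: "B \<in> sets \<mu> \<longleftrightarrow> B \<in> sets borel \<and> B \<subseteq> ?W" for B
    using assms(7) W
    by (auto simp: distribution_is_measure_def locally_finite_borel_on_def sets_restrict_space_iff)
  have \<sigma>: "1 \<le> enn2real (of_nat CARD('n) / r) + enn2real (2 / q)"
    using assms(12) by linarith
  have ac: "emeasure \<mu> A = 0"
    if A: "A \<in> sets borel" "A \<subseteq> ?W" and null: "parabolic_measure s A = 0" for A
  proof (rule emeasure_eq_0_if_locally_null)
    show "A \<in> sets \<mu>" and "\<And>U. open U \<Longrightarrow> A \<inter> U \<in> sets \<mu>" using A by (auto simp: sets)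
    fix z assume "z \<in> A"
    then obtain x0 t0 where z: "z = (x0, t0)" "(x0, t0) \<in> ?W" using A(2) by (cases z) auto
    obtain R C where R: "R > 0" and C: "C \<ge> 0" and growth: "\<And>x t \<delta>. 0 < \<delta> \<Longrightarrow> \<delta> \<le> R \<Longrightarrow>
        parabolic_cylinder \<delta> x t \<inter> (ball x0 R \<times> ball t0 R) \<noteq> {} \<Longrightarrow>
        parabolic_cylinder \<delta> x t \<subseteq> ?W \<and>
        emeasure \<mu> (parabolic_cylinder \<delta> x t) \<le> ennreal (C * \<delta> powr s)"
      using dissipation_parabolic_growth[OF assms(1) \<Omega> assms(7-11) \<sigma> z(2)]
      unfolding assms(13)[symmetric] by blast
    let ?U = "ball x0 R \<times> ball t0 R"
    have U: "open ?U" by (intro open_Times) auto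
    have "emeasure \<mu> (A \<inter> ?U) = 0"
    proof (rule emeasure_eq_0_if_parabolic_measure_eq_0[OF _ Int_lower2 _ R C])
      show "A \<inter> ?U \<in> sets \<mu>" using A U by (auto simp: sets)
      show "parabolic_measure s (A \<inter> ?U) = 0"
        by (rule parabolic_measure_eq_0_mono[OF null]) auto
      fix x t \<delta> assume "0 < \<delta>" "\<delta> \<le> R" "parabolic_cylinder \<delta> x t \<inter> ?U \<noteq> {}"
      moreover have "open (parabolic_cylinder \<delta> x t)"
        unfolding parabolic_cylinder_def by (intro open_Times) auto
      ultimately show "parabolic_cylinder \<delta> x t \<in> sets \<mu> \<and>
          emeasure \<mu> (parabolic_cylinder \<delta> x t) \<le> ennreal (C * \<delta> powr s)"
        using growth[of \<delta> x t] by (simp add: sets)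
    qed
    then show "\<exists>U. open U \<and> z \<in> U \<and> emeasure \<mu> (A \<inter> U) = 0"
      using U R z by (intro exI[of _ ?U]) auto
  qed
  have dim: "parabolic_dim S \<ge> ereal s"
    if S: "S \<in> sets borel" and "emeasure \<mu> ?W \<noteq> 0" and conc: "concentrated_on \<mu> S" for S
    unfolding parabolic_dim_def
  proof (rule Inf_greatest, safe)
    fix s' assume null: "parabolic_measure s' S = 0"
    show "ereal s \<le> ereal s'"
    proof (rule ccontr)
      \<comment> \<open>Otherwise \<open>S\<close> is null for the exponent \<open>s\<close>, so absolute continuity makes \<open>\<mu>\<close> vanish.\<close>
      assume "\<not> ereal s \<le> ereal s'"
      then have "parabolic_measure s (?W \<inter> S) = 0"
        by (intro parabolic_measure_eq_0_mono[OF null]) auto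
      then have "emeasure \<mu> (?W \<inter> S) = 0" using S W by (intro ac) auto
      moreover have "emeasure \<mu> ?W = emeasure \<mu> (?W \<inter> S)"
        using conc W by (auto simp: concentrated_on_def sets)
      ultimately show False using \<open>emeasure \<mu> ?W \<noteq> 0\<close> by simp
    qed
  qed
  show ?thesis using ac dim by blast
qed

end
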